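(* Let $H\in(\tfrac12,1)$, let $(L_t)_{t\ge0}$ be a Lévy process without Gaussian component with $\mathbb E L_1=0$, $\mathbb E L_1^2<\infty$, and let $Y_t=\int_0^t z_H(t,s)\,dL_s$ be the fLpMG. Then for all $t>0$, $$\sum_{j=1}^{2^n}\big(Y_{jt/2^n}-Y_{(j-1)t/2^n}\big)^2\to0\quad\text{a.s. as } n\to\infty.$$
   Context: Molchan–Golosov kernel for $H>\tfrac12$: $z_H(t,s)=(H-\tfrac12)c_Hs^{1/2-H}\int_s^t u^{H-1/2}(u-s)^{H-3/2}du$ for $0<s<t$, $0$ otherwise, with $c_H=\frac{1}{\Gamma(H+1/2)}\big(\frac{2H\Gamma(H+1/2)\Gamma(3/2-H)}{\Gamma(2-2H)}\big)^{1/2}$. The integral is the $L^2(\mathbb P)$-limit of integrals of step functions. *)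

theory Defs
  imports "HOL-Probability.Probability"
begin

definition cH :: "real \<Rightarrow> real" where
  "cH H = (1 / Gamma (H + 1/2)) *
     sqrt (2 * H * Gamma (H + 1/2) * Gamma (3/2 - H) / Gamma (2 - 2 * H))"

definition zH :: "real \<Rightarrow> real \<Rightarrow> real \<Rightarrow> real" where
  "zH H t s = (if 0 < s \<and> s < t then
      (H - 1/2) * cH H * s powr (1/2 - H) *
        (LBINT u=s..t. u powr (H - 1/2) * (u - s) powr (H - 3/2))
    else 0)"

definition step_fun :: "nat \<Rightarrow> (nat \<Rightarrow> real) \<Rightarrow> (nat \<Rightarrow> real) \<Rightarrow> real \<Rightarrow> real" where
  "step_fun n ts a s = (\<Sum>i<n. a i * indicator {ts i<..ts (Suc i)} s)"

definition step_int :: "(real \<Rightarrow> 'a \<Rightarrow> real) \<Rightarrow> nat \<Rightarrow> (nat \<Rightarrow> real) \<Rightarrow> (nat \<Rightarrow> real) \<Rightarrow> 'a \<Rightarrow> real" where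
  "step_int L n ts a \<omega> = (\<Sum>i<n. a i * (L (ts (Suc i)) \<omega> - L (ts i) \<omega>))"

text \<open>X is (a version of) the integral of the deterministic function f over [0,t]
  w.r.t. L: the L^2(P)-limit of the integrals of step functions approximating f
  in L^2([0,t]).\<close>
definition wiener_integral ::
  "'a measure \<Rightarrow> (real \<Rightarrow> 'a \<Rightarrow> real) \<Rightarrow> real \<Rightarrow> (real \<Rightarrow> real) \<Rightarrow> ('a \<Rightarrow> real) \<Rightarrow> bool" where
  "wiener_integral M L t f X \<longleftrightarrow>
     X \<in> borel_measurable M \<and>
     (\<exists>(n :: nat \<Rightarrow> nat) (ts :: nat \<Rightarrow> nat \<Rightarrow> real) (a :: nat \<Rightarrow> nat \<Rightarrow> real).
        (\<forall>k. ts k 0 = 0 \<and> ts k (n k) = t \<and> (\<forall>i<n k. ts k i \<le> ts k (Suc i))) \<and>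
        (\<lambda>k. \<integral>\<^sup>+ s\<in>{0..t}. ennreal ((f s - step_fun (n k) (ts k) (a k) s)\<^sup>2) \<partial>lborel)
           \<longlonglongrightarrow> 0 \<and>
        (\<lambda>k. \<integral>\<^sup>+ \<omega>. ennreal ((X \<omega> - step_int L (n k) (ts k) (a k) \<omega>)\<^sup>2) \<partial>M)
           \<longlonglongrightarrow> 0)"

definition levy_process :: "'a measure \<Rightarrow> (real \<Rightarrow> 'a \<Rightarrow> real) \<Rightarrow> bool" where
  "levy_process M L \<longleftrightarrow>
     prob_space M \<and>
     (\<forall>t. L t \<in> borel_measurable M) \<and>
     (AE \<omega> in M. L 0 \<omega> = 0) \<and>
     (\<forall>(n::nat) (ts :: nat \<Rightarrow> real). 0 \<le> ts 0 \<and> (\<forall>i<n. ts i \<le> ts (Suc i)) \<longrightarrow>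
        prob_space.indep_vars M (\<lambda>_. borel) (\<lambda>i \<omega>. L (ts (Suc i)) \<omega> - L (ts i) \<omega>) {..<n}) \<and>
     (\<forall>s t. 0 \<le> s \<longrightarrow> 0 \<le> t \<longrightarrow>
        distr M borel (\<lambda>\<omega>. L (s + t) \<omega> - L s \<omega>) = distr M borel (L t)) \<and>
     (\<forall>t\<ge>0. \<forall>e>0. ((\<lambda>s. measure M {\<omega> \<in> space M. \<bar>L s \<omega> - L t \<omega>\<bar> > e})
                       \<longlongrightarrow> 0) (at t within {0..})) \<and>
     (AE \<omega> in M. \<forall>t\<ge>0. continuous (at_right t) (\<lambda>s. L s \<omega>) \<and>
                        (t > 0 \<longrightarrow> (\<exists>l. ((\<lambda>s. L s \<omega>) \<longlongrightarrow> l) (at_left t))))"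

text \<open>Levy--Khintchine triplet of L_1 has zero Gaussian part: there are b and a
  Levy measure \<nu> with char. function exp(i u b + \<integral>(e^{iux}-1-iux 1_{|x|\<le>1}) \<nu>(dx)).\<close>
definition no_gaussian_component :: "'a measure \<Rightarrow> (real \<Rightarrow> 'a \<Rightarrow> real) \<Rightarrow> bool" where
  "no_gaussian_component M L \<longleftrightarrow>
     (\<exists>(b::real) (\<nu>::real measure).
        sets \<nu> = sets borel \<and> emeasure \<nu> {0} = 0 \<and>
        (\<integral>\<^sup>+ x. ennreal (min 1 (x\<^sup>2)) \<partial>\<nu>) < \<infinity> \<and>
        (\<forall>u. char (distr M borel (L 1)) u =
           exp (\<i> * complex_of_real (u * b) +
                (CLINT x|\<nu>. iexp (u * x) - 1 - \<i> * complex_of_real (u * x) * indicator {-1..1} x))))"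

end

theory Submission
  imports Defs
begin

text \<open>For a centred square-integrable Levy process the integral of a deterministic function is, up
  to a factor, an \<open>L\<^sup>2\<close>-isometry, because the covariance of the process is a multiple of
  \<open>min s t\<close>. Writing \<open>\<alpha> = H - 1/2\<close>, the kernel increment over \<open>[s, s + h]\<close> has squared
  \<open>L\<^sup>2\<close>-norm at most \<open>C h\<^bsup>1+\<alpha>\<^esup>\<close> whenever \<open>s = 0\<close> or \<open>h \<le> s\<close>, which covers all cells of a dyadic
  grid. (The sharp exponent \<open>2 H = 1 + 2 \<alpha>\<close> is not needed.) Hence the expected sum of squares at
  level \<open>n\<close> decays like \<open>2\<^bsup>-n\<alpha>\<^esup>\<close>, and summability over \<open>n\<close> gives almost sure convergence to 0.\<close>

section \<open>Covariance of the process\<close>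

text \<open>Mean zero and square integrability are given at time 1 only, while the isometry wants
  them at every time. Fubini and doubling spread the second moment. The mean is additive in time,
  but additivity alone does not give linearity; a bound near 0 has to be extracted from stochastic
  continuity, which controls probabilities rather than expectations. On the kernel side the exponent
  of \<open>h\<close> must exceed 1, because level \<open>n\<close> has \<open>2^n\<close> cells of
  length proportional to \<open>2^-n\<close>. Each of the two natural estimates of a power increment
  fails when squared: one yields only \<open>h^(2 \<alpha>)\<close> with
  \<open>2 \<alpha> < 1\<close>, the other a singularity that is not integrable. Their product
  yields \<open>h^(1 + \<alpha>)\<close> with an integrable one. The restriction to
  \<open>s = 0\<close> or \<open>h \<le> s\<close> keeps \<open>s + h\<close> comparable to
  \<open>s\<close> off the first cell, so that the growth factor of the kernel absorbs the negative
  power of \<open>s\<close> left by the singularities.\<close>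

lemma additive_bounded_near_0_imp_linear:
  fixes f :: "real \<Rightarrow> real"
  assumes add: "\<And>s t. 0 \<le> s \<Longrightarrow> 0 \<le> t \<Longrightarrow> f (s + t) = f s + f t"
    and "0 < \<delta>" and bound: "\<And>t. 0 \<le> t \<Longrightarrow> t < \<delta> \<Longrightarrow> \<bar>f t\<bar> \<le> C"
    and "0 \<le> t"
  shows "f t = t * f 1"
proof -
  have mult: "f (real n * x) = real n * f x" if "0 \<le> x" for n x
  proof (induction n)
    case 0
    show ?case using add[of 0 0] by simp
  next
    case (Suc n)
    then show ?case using add[of "real n * x" x] that by (simp add: algebra_simps)
  qed
  obtain p :: nat where p: "0 < p" "1 / real p < \<delta>"
    using \<open>0 < \<delta>\<close> by (metis nat_approx_posE of_nat_0_less_iff zero_less_Suc)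
  have f_unit: "f (1 / real p) = f 1 / real p"
    using mult[of "1 / real p" p] p by (simp add: field_simps)
  \<comment> \<open>The defect \<open>f t - t * f 1\<close> is additive in \<open>t\<close> and
    vanishes at \<open>1 / real p\<close>. At \<open>real n * t\<close> it therefore equals its
    value at the remainder \<open>r\<close> modulo \<open>1 / real p\<close>, which is bounded
    independently of \<open>n\<close> since \<open>r < \<delta>\<close>. A number all of whose
    multiples are bounded is 0.\<close>
  have "real n * \<bar>f t - t * f 1\<bar> \<le> C + \<bar>f 1\<bar>" for n
  proof -
    define k where "k = nat \<lfloor>real n * t * real p\<rfloor>"
    define r where "r = real n * t - real k * (1 / real p)"
    have "real k \<le> real n * t * real p" "real n * t * real p < real k + 1"
      unfolding k_def using \<open>0 \<le> t\<close> by (auto simp: of_nat_nat)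
    moreover have "r * real p = real n * t * real p - real k"
      unfolding r_def using p by (simp add: algebra_simps)
    ultimately have "0 \<le> r * real p" "r * real p < 1" by linarith+
    then have r: "0 \<le> r" "r < 1 / real p"
      using p by (auto simp: zero_le_mult_iff pos_less_divide_eq)
    have "real n * f t = f (real k * (1 / real p) + r)"
      using mult[of t n] \<open>0 \<le> t\<close> unfolding r_def by simp
    also have "\<dots> = real k * (1 / real p) * f 1 + f r"
      using add[of "real k * (1 / real p)" r] r mult[of "1 / real p" k] f_unit by simp
    finally have "real n * (f t - t * f 1) = f r - r * f 1"
      unfolding r_def by (simp add: algebra_simps)
    then have "real n * \<bar>f t - t * f 1\<bar> = \<bar>f r - r * f 1\<bar>"
      by (metis abs_mult abs_of_nat)
    also have "\<dots> \<le> \<bar>f r\<bar> + r * \<bar>f 1\<bar>"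
      using r by (metis abs_mult abs_of_nonneg abs_triangle_ineq4)
    also have "\<dots> \<le> C + 1 * \<bar>f 1\<bar>"
    proof (intro add_mono mult_right_mono)
      show "\<bar>f r\<bar> \<le> C" using bound r p by simp
      have "1 / real p \<le> 1" using p by simp
      then show "r \<le> 1" using r by linarith
    qed simp
    finally show ?thesis by simp
  qed
  then have "\<not> 0 < \<bar>f t - t * f 1\<bar>"
    by (metis ex_less_of_nat_mult not_le)
  then show ?thesis by simp
qed

text \<open>By Fubini, \<open>x + Y\<close> is square integrable for almost every \<open>x\<close>
  under the law of \<open>X\<close>; a single such \<open>x\<close> suffices, since a constant shift
  preserves square integrability. This passes from \<open>L 1\<close> to its increments.\<close>

lemma (in prob_space) square_integrable_indep_summand:
  fixes X Y :: "'a \<Rightarrow> real"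
  assumes ind: "indep_var borel X borel Y" and int: "integrable M (\<lambda>\<omega>. (X \<omega> + Y \<omega>)\<^sup>2)"
  shows "integrable M (\<lambda>\<omega>. (Y \<omega>)\<^sup>2)"
proof -
  have [measurable]: "X \<in> borel_measurable M" "Y \<in> borel_measurable M"
    using ind by (auto dest: indep_var_rv1 indep_var_rv2)
  interpret X: prob_space "distr M borel X" by (rule prob_space_distr) simp
  interpret Y: prob_space "distr M borel Y" by (rule prob_space_distr) simp
  interpret pair_sigma_finite "distr M borel X" "distr M borel Y" ..
  have eq: "distr M borel X \<Otimes>\<^sub>M distr M borel Y = distr M (borel \<Otimes>\<^sub>M borel) (\<lambda>\<omega>. (X \<omega>, Y \<omega>))"
    using ind by (simp add: indep_var_distribution_eq)
  have "integrable (distr M borel X \<Otimes>\<^sub>M distr M borel Y) (\<lambda>(x, y). (x + y)\<^sup>2)"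
    unfolding eq using int by (subst integrable_distr_eq) (auto simp: case_prod_beta)
  then have "AE x in distr M borel X. integrable (distr M borel Y) (\<lambda>y. (x + y)\<^sup>2)"
    by (rule AE_integrable_fst)
  then obtain x where "integrable (distr M borel Y) (\<lambda>y. (x + y)\<^sup>2)"
    using eventually_happens'[OF X.ae_filter_bot] by blast
  then have x: "integrable M (\<lambda>\<omega>. (x + Y \<omega>)\<^sup>2)"
    by (subst (asm) integrable_distr_eq) auto
  have "integrable M (\<lambda>\<omega>. 2 * (x + Y \<omega>)\<^sup>2 + 2 * x\<^sup>2)"
    using x by simp
  then show ?thesis
  proof (rule Bochner_Integration.integrable_bound)
    show "AE \<omega> in M. norm ((Y \<omega>)\<^sup>2) \<le> norm (2 * (x + Y \<omega>)\<^sup>2 + 2 * x\<^sup>2)"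
    proof (rule AE_I2)
      fix \<omega>
      \<comment> \<open>The square is exactly the difference between
        \<open>2 * (x + y)^2 + 2 * x^2\<close> and \<open>y^2\<close>, where \<open>y\<close> is the
        value of \<open>Y\<close>.\<close>
      have "0 \<le> (2 * x + Y \<omega>)\<^sup>2" by simp
      then show "norm ((Y \<omega>)\<^sup>2) \<le> norm (2 * (x + Y \<omega>)\<^sup>2 + 2 * x\<^sup>2)"
        by (simp add: power2_eq_square algebra_simps)
    qed
  qed simp
qed

lemma integrable_mult_of_square:
  fixes f g :: "'a \<Rightarrow> real"
  assumes [measurable]: "f \<in> borel_measurable M" "g \<in> borel_measurable M"
    and "integrable M (\<lambda>x. (f x)\<^sup>2)" "integrable M (\<lambda>x. (g x)\<^sup>2)"
  shows "integrable M (\<lambda>x. f x * g x)"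
proof (rule Bochner_Integration.integrable_bound)
  show "integrable M (\<lambda>x. (f x)\<^sup>2 + (g x)\<^sup>2)" using assms by simp
  show "AE x in M. norm (f x * g x) \<le> norm ((f x)\<^sup>2 + (g x)\<^sup>2)"
  proof (rule AE_I2)
    fix x
    have "2 * (\<bar>f x\<bar> * \<bar>g x\<bar>) \<le> (f x)\<^sup>2 + (g x)\<^sup>2"
      using sum_squares_bound[of "\<bar>f x\<bar>" "\<bar>g x\<bar>"] by (simp add: mult.assoc)
    moreover have "0 \<le> \<bar>f x\<bar> * \<bar>g x\<bar>" by simp
    ultimately have "\<bar>f x\<bar> * \<bar>g x\<bar> \<le> (f x)\<^sup>2 + (g x)\<^sup>2"
      by linarith
    then show "norm (f x * g x) \<le> norm ((f x)\<^sup>2 + (g x)\<^sup>2)"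
      by (simp add: abs_mult)
  qed
qed simp

section \<open>Means, second moments and covariances at all times\<close>

locale centred_L2_levy = prob_space M for M :: "'a measure" +
  fixes L :: "real \<Rightarrow> 'a \<Rightarrow> real"
  assumes levy: "levy_process M L"
    and mean_1: "expectation (L 1) = 0"
    and square_integrable_1: "integrable M (\<lambda>\<omega>. (L 1 \<omega>)\<^sup>2)"
begin

lemma measurable_L [measurable]: "L t \<in> borel_measurable M"
  using levy by (simp add: levy_process_def)

lemma AE_L_0: "AE \<omega> in M. L 0 \<omega> = 0"
  using levy by (simp add: levy_process_def)

lemma distr_increment:
  "0 \<le> s \<Longrightarrow> 0 \<le> t \<Longrightarrow> distr M borel (\<lambda>\<omega>. L (s + t) \<omega> - L s \<omega>) = distr M borel (L t)"
  using levy by (simp add: levy_process_def)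

lemma indep_increments:
  assumes "0 \<le> s" "0 \<le> t"
  shows "indep_var borel (\<lambda>\<omega>. L s \<omega> - L 0 \<omega>) borel (\<lambda>\<omega>. L (s + t) \<omega> - L s \<omega>)"
proof -
  \<comment> \<open>Two cells, from 0 to \<open>s\<close> and from \<open>s\<close> to
    \<open>s + t\<close>. The first increment stays \<open>L s - L 0\<close>, because
    \<open>L 0\<close> vanishes only almost surely.\<close>
  define \<tau> where "\<tau> i = (if i = 0 then 0 else if i = Suc 0 then s else s + t)" for i :: nat
  have "0 \<le> \<tau> 0 \<and> (\<forall>i<2. \<tau> i \<le> \<tau> (Suc i))"
    using assms by (auto simp: \<tau>_def less_2_cases_iff)
  moreover have "\<forall>(n::nat) \<tau>. 0 \<le> \<tau> 0 \<and> (\<forall>i<n. \<tau> i \<le> \<tau> (Suc i)) \<longrightarrow>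
      indep_vars (\<lambda>_. borel) (\<lambda>i \<omega>. L (\<tau> (Suc i)) \<omega> - L (\<tau> i) \<omega>) {..<n}"
    using levy unfolding levy_process_def by (elim conjE)
  ultimately have "indep_vars (\<lambda>_. borel) (\<lambda>i \<omega>. L (\<tau> (Suc i)) \<omega> - L (\<tau> i) \<omega>) {..<2}"
    by blast
  also have "{..<2} = insert 0 {Suc 0}" by auto
  \<comment> \<open>Independence of one member from the sum of the others, with a single other
    member, turns the family statement into one about a pair.\<close>
  finally have "indep_var borel (\<lambda>\<omega>. L (\<tau> (Suc 0)) \<omega> - L (\<tau> 0) \<omega>)
      borel (\<lambda>\<omega>. \<Sum>i\<in>{Suc 0}. L (\<tau> (Suc i)) \<omega> - L (\<tau> i) \<omega>)"
    by (intro indep_vars_sum) auto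
  then show ?thesis by (simp add: \<tau>_def)
qed

lemma square_integrable_increment_iff:
  assumes "0 \<le> s" "0 \<le> t"
  shows "integrable M (\<lambda>\<omega>. (L (s + t) \<omega> - L s \<omega>)\<^sup>2) \<longleftrightarrow> integrable M (\<lambda>\<omega>. (L t \<omega>)\<^sup>2)"
proof -
  have "integrable M (\<lambda>\<omega>. (L (s + t) \<omega> - L s \<omega>)\<^sup>2) \<longleftrightarrow>
      integrable (distr M borel (\<lambda>\<omega>. L (s + t) \<omega> - L s \<omega>)) (\<lambda>x. x\<^sup>2)"
    by (subst integrable_distr_eq) auto
  also have "\<dots> \<longleftrightarrow> integrable M (\<lambda>\<omega>. (L t \<omega>)\<^sup>2)"
    unfolding distr_increment[OF assms] by (subst integrable_distr_eq) auto
  finally show ?thesis .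
qed

lemma expectation_increment:
  assumes "0 \<le> s" "0 \<le> t"
  shows "expectation (\<lambda>\<omega>. L (s + t) \<omega> - L s \<omega>) = expectation (L t)"
proof -
  have "expectation (\<lambda>\<omega>. L (s + t) \<omega> - L s \<omega>) =
      integral\<^sup>L (distr M borel (\<lambda>\<omega>. L (s + t) \<omega> - L s \<omega>)) (\<lambda>x. x)"
    by (subst integral_distr) auto
  also have "\<dots> = expectation (L t)"
    unfolding distr_increment[OF assms] by (subst integral_distr) auto
  finally show ?thesis .
qed

lemma expectation_increment_square:
  assumes "0 \<le> s" "0 \<le> t"
  shows "expectation (\<lambda>\<omega>. (L (s + t) \<omega> - L s \<omega>)\<^sup>2) = expectation (\<lambda>\<omega>. (L t \<omega>)\<^sup>2)"
proof -
  have "expectation (\<lambda>\<omega>. (L (s + t) \<omega> - L s \<omega>)\<^sup>2) =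
      integral\<^sup>L (distr M borel (\<lambda>\<omega>. L (s + t) \<omega> - L s \<omega>)) (\<lambda>x. x\<^sup>2)"
    by (subst integral_distr) auto
  also have "\<dots> = expectation (\<lambda>\<omega>. (L t \<omega>)\<^sup>2)"
    unfolding distr_increment[OF assms] by (subst integral_distr) auto
  finally show ?thesis .
qed

text \<open>For \<open>t \<le> 1\<close>, \<open>L 1 - L 0\<close> splits into independent
  increments over \<open>[0, 1 - t]\<close> and \<open>[1 - t, 1]\<close>, and the second has the
  law of \<open>L t\<close>. Larger times are reached by doubling: \<open>L t\<close> is
  \<open>L (t / 2)\<close> plus an increment with the same law.\<close>

lemma square_integrable_L:
  assumes "0 \<le> t"
  shows "integrable M (\<lambda>\<omega>. (L t \<omega>)\<^sup>2)"
proof -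
  have "0 \<le> t \<Longrightarrow> t \<le> 2 ^ n \<Longrightarrow> integrable M (\<lambda>\<omega>. (L t \<omega>)\<^sup>2)" for n :: nat and t
  proof (induction n arbitrary: t)
    case 0
    have ind: "indep_var borel (\<lambda>\<omega>. L (1 - t) \<omega> - L 0 \<omega>) borel (\<lambda>\<omega>. L 1 \<omega> - L (1 - t) \<omega>)"
      using indep_increments[of "1 - t" t] 0 by simp
    have "integrable M (\<lambda>\<omega>. (L 1 \<omega> - L 0 \<omega>)\<^sup>2)"
      using square_integrable_increment_iff[of 0 1] square_integrable_1 by simp
    then have "integrable M (\<lambda>\<omega>. (L 1 \<omega> - L (1 - t) \<omega>)\<^sup>2)"
      by (intro square_integrable_indep_summand[OF ind]) simp
    then show ?case
      using square_integrable_increment_iff[of "1 - t" t] 0 by simp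
  next
    case (Suc n)
    then have half: "integrable M (\<lambda>\<omega>. (L (t / 2) \<omega>)\<^sup>2)" by simp
    moreover have "integrable M (\<lambda>\<omega>. (L t \<omega> - L (t / 2) \<omega>)\<^sup>2)"
      using square_integrable_increment_iff[of "t / 2" "t / 2"] half Suc.prems by simp
    ultimately have "integrable M (\<lambda>\<omega>. 2 * (L (t / 2) \<omega>)\<^sup>2 + 2 * (L t \<omega> - L (t / 2) \<omega>)\<^sup>2)"
      by simp
    then show ?case
    proof (rule Bochner_Integration.integrable_bound)
      show "AE \<omega> in M. norm ((L t \<omega>)\<^sup>2)
          \<le> norm (2 * (L (t / 2) \<omega>)\<^sup>2 + 2 * (L t \<omega> - L (t / 2) \<omega>)\<^sup>2)"
      proof (rule AE_I2)
        fix \<omega>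
        have "0 \<le> (L t \<omega> - 2 * L (t / 2) \<omega>)\<^sup>2" by simp
        then show "norm ((L t \<omega>)\<^sup>2)
          \<le> norm (2 * (L (t / 2) \<omega>)\<^sup>2 + 2 * (L t \<omega> - L (t / 2) \<omega>)\<^sup>2)"
          by (simp add: power2_eq_square algebra_simps)
      qed
    qed simp
  qed
  moreover obtain n :: nat where "t \<le> 2 ^ n"
    using real_arch_pow[of 2 t] less_imp_le by auto
  ultimately show ?thesis using assms by blast
qed

lemma integrable_L: "0 \<le> t \<Longrightarrow> integrable M (L t)"
  using square_integrable_imp_integrable[OF measurable_L square_integrable_L] .

lemma integrable_mult_L: "0 \<le> s \<Longrightarrow> 0 \<le> t \<Longrightarrow> integrable M (\<lambda>\<omega>. L s \<omega> * L t \<omega>)"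
  by (intro integrable_mult_of_square square_integrable_L) auto

lemma expectation_L_add:
  assumes "0 \<le> s" "0 \<le> t"
  shows "expectation (L (s + t)) = expectation (L s) + expectation (L t)"
  using expectation_increment[OF assms] assms
  by (subst (asm) Bochner_Integration.integral_diff) (auto intro: integrable_L)

lemma expectation_indep_mult:
  assumes "0 \<le> s" "0 \<le> t"
  shows "expectation (\<lambda>\<omega>. L s \<omega> * (L (s + t) \<omega> - L s \<omega>)) = expectation (L s) * expectation (L t)"
proof -
  have "expectation (\<lambda>\<omega>. L s \<omega> * (L (s + t) \<omega> - L s \<omega>)) =
      expectation (\<lambda>\<omega>. (L s \<omega> - L 0 \<omega>) * (L (s + t) \<omega> - L s \<omega>))"
    using AE_L_0 by (intro integral_cong_AE) auto
  also have "\<dots> = expectation (\<lambda>\<omega>. L s \<omega> - L 0 \<omega>) * expectation (\<lambda>\<omega>. L (s + t) \<omega> - L s \<omega>)"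
    using assms by (intro indep_var_lebesgue_integral indep_increments)
      (auto intro!: integrable_L Bochner_Integration.integrable_diff)
  finally show ?thesis
    using expectation_increment[of 0 s] expectation_increment[of s t] assms by simp
qed

text \<open>The means at times other than 1 are still unknown here, so the cross term has to be
  carried along.\<close>

lemma expectation_square_L_add:
  assumes "0 \<le> s" "0 \<le> t"
  shows "expectation (\<lambda>\<omega>. (L (s + t) \<omega>)\<^sup>2) = expectation (\<lambda>\<omega>. (L s \<omega>)\<^sup>2)
    + expectation (\<lambda>\<omega>. (L t \<omega>)\<^sup>2) + 2 * (expectation (L s) * expectation (L t))"
proof -
  have 1: "integrable M (\<lambda>\<omega>. (L (s + t) \<omega> - L s \<omega>)\<^sup>2)"
    using square_integrable_increment_iff square_integrable_L assms by blast
  have 2: "integrable M (\<lambda>\<omega>. L s \<omega> * (L (s + t) \<omega> - L s \<omega>))"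
    using assms by (intro integrable_mult_of_square 1 square_integrable_L) auto
  have "expectation (\<lambda>\<omega>. (L (s + t) \<omega>)\<^sup>2) = expectation (\<lambda>\<omega>. (L s \<omega>)\<^sup>2 + (L (s + t) \<omega> - L s \<omega>)\<^sup>2
      + 2 * (L s \<omega> * (L (s + t) \<omega> - L s \<omega>)))"
    by (intro Bochner_Integration.integral_cong) (auto simp: power2_eq_square algebra_simps)
  also have "\<dots> = expectation (\<lambda>\<omega>. (L s \<omega>)\<^sup>2) + expectation (\<lambda>\<omega>. (L (s + t) \<omega> - L s \<omega>)\<^sup>2)
      + 2 * expectation (\<lambda>\<omega>. L s \<omega> * (L (s + t) \<omega> - L s \<omega>))"
    using 1 2 assms square_integrable_L[of s] by simp
  finally show ?thesis
    using expectation_indep_mult[OF assms] expectation_increment_square[OF assms] by simp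
qed

text \<open>Variances of independent increments add, and \<open>L 1\<close> has mean zero, so its
  second moment is the variance of \<open>L t\<close> plus that of \<open>L (1 - t)\<close>. This
  controls fluctuations uniformly in \<open>t\<close> before anything is known about the
  means.\<close>

lemma variance_L_le:
  assumes "0 \<le> t" "t \<le> 1"
  shows "variance (L t) \<le> expectation (\<lambda>\<omega>. (L 1 \<omega>)\<^sup>2)"
proof -
  have var: "variance (L u) = expectation (\<lambda>\<omega>. (L u \<omega>)\<^sup>2) - (expectation (L u))\<^sup>2" if "0 \<le> u" for u
    using that by (intro variance_eq integrable_L square_integrable_L)
  have "expectation (L (1 - t)) = - expectation (L t)"
    using expectation_L_add[of t "1 - t"] assms mean_1 by simp
  then have "expectation (\<lambda>\<omega>. (L 1 \<omega>)\<^sup>2) = expectation (\<lambda>\<omega>. (L t \<omega>)\<^sup>2) - (expectation (L t))\<^sup>2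
      + (expectation (\<lambda>\<omega>. (L (1 - t) \<omega>)\<^sup>2) - (expectation (L (1 - t)))\<^sup>2)"
    using expectation_square_L_add[of t "1 - t"] assms
    by (simp add: power2_eq_square[of "expectation _"])
  then have "expectation (\<lambda>\<omega>. (L 1 \<omega>)\<^sup>2) = variance (L t) + variance (L (1 - t))"
    using var[of t] var[of "1 - t"] assms by argo
  moreover have "0 \<le> variance (L (1 - t))" by (rule variance_positive)
  ultimately show ?thesis by linarith
qed

text \<open>By Chebyshev's inequality and stochastic continuity, near time 0 the value of the process
  is with positive probability simultaneously close to its mean and bounded by 1.\<close>

lemma mean_bounded_near_0:
  obtains \<delta> C where "0 < \<delta>" "\<And>t. 0 \<le> t \<Longrightarrow> t < \<delta> \<Longrightarrow> \<bar>expectation (L t)\<bar> \<le> C"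
proof -
  define V where "V = expectation (\<lambda>\<omega>. (L 1 \<omega>)\<^sup>2)"
  have "0 \<le> V" unfolding V_def by simp
  \<comment> \<open>Chosen so that Chebyshev leaves probability below 1/2: \<open>c \<ge> 1\<close>
    gives \<open>c^2 \<ge> c > 2 * V\<close>.\<close>
  define c where "c = 2 * V + 1"
  have "1 \<le> c" "V / c\<^sup>2 < 1 / 2"
  proof -
    show "1 \<le> c" using \<open>0 \<le> V\<close> by (simp add: c_def)
    then have "c * 1 \<le> c * c" by (intro mult_left_mono) auto
    moreover have "2 * V < c" by (simp add: c_def)
    ultimately have "2 * V < c\<^sup>2" by (simp add: power2_eq_square)
    then show "V / c\<^sup>2 < 1 / 2" using \<open>1 \<le> c\<close> by (simp add: field_simps)
  qed
  have "((\<lambda>s. prob {\<omega> \<in> space M. \<bar>L s \<omega> - L 0 \<omega>\<bar> > 1}) \<longlongrightarrow> 0) (at 0 within {0..})"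
    using levy unfolding levy_process_def by force
  then have "\<forall>\<^sub>F s in at 0 within {0..}. prob {\<omega> \<in> space M. \<bar>L s \<omega> - L 0 \<omega>\<bar> > 1} < 1 / 2"
    by (rule order_tendstoD) simp
  then obtain d where d: "0 < d"
    "\<And>s. 0 \<le> s \<Longrightarrow> s \<noteq> 0 \<Longrightarrow> s < d \<Longrightarrow> prob {\<omega> \<in> space M. \<bar>L s \<omega> - L 0 \<omega>\<bar> > 1} < 1 / 2"
    unfolding eventually_at by (auto simp: dist_real_def)
  have "\<bar>expectation (L t)\<bar> \<le> c + 1" if t: "0 \<le> t" "t < min d 1" for t
  proof (cases "t = 0")
    case True
    then show ?thesis using expectation_increment[of 0 0] \<open>1 \<le> c\<close> by simp
  next
    case False
    define A where "A = {\<omega> \<in> space M. \<bar>L t \<omega> - L 0 \<omega>\<bar> > 1}"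
    define B where "B = {\<omega> \<in> space M. c \<le> \<bar>L t \<omega> - expectation (L t)\<bar>}"
    have AB: "A \<in> events" "B \<in> events" unfolding A_def B_def by measurable
    have "prob B \<le> variance (L t) / c\<^sup>2"
      unfolding B_def using t \<open>1 \<le> c\<close> by (intro Chebyshev_inequality square_integrable_L) auto
    also have "\<dots> \<le> V / c\<^sup>2"
      using variance_L_le[of t] t unfolding V_def by (intro divide_right_mono) auto
    finally have "prob B < 1 / 2" using \<open>V / c\<^sup>2 < 1 / 2\<close> by linarith
    moreover have "prob A < 1 / 2" unfolding A_def using d t False by simp
    \<comment> \<open>Two events of probability below 1/2 cannot cover the space, so some outcome
      with \<open>L 0 = 0\<close> avoids both. There \<open>L t\<close> is at most 1 in absolute
      value and within \<open>c\<close> of its mean, which bounds the mean, a deterministic number,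
      by \<open>c + 1\<close>.\<close>
    ultimately have "prob (A \<union> B) < 1"
      using measure_Un_le[OF AB] by simp
    then have "\<not> (AE \<omega> in M. \<omega> \<in> A \<union> B)"
      using AB prob_eq_1[of "A \<union> B"] by auto
    moreover have "AE \<omega> in M. \<omega> \<in> A \<union> B" if "\<And>\<omega>. \<omega> \<in> space M \<Longrightarrow> L 0 \<omega> = 0 \<Longrightarrow> \<omega> \<in> A \<union> B"
      using AE_L_0 AE_space by eventually_elim (use that in blast)
    ultimately obtain \<omega> where "\<omega> \<in> space M" "L 0 \<omega> = 0" "\<omega> \<notin> A" "\<omega> \<notin> B" by blast
    then show ?thesis unfolding A_def B_def by auto
  qed
  then show ?thesis using that[of "min d 1" "c + 1"] d by simp
qed

lemma expectation_L: "0 \<le> t \<Longrightarrow> expectation (L t) = 0"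
proof -
  assume "0 \<le> t"
  obtain \<delta> C where "0 < \<delta>" "\<And>t. 0 \<le> t \<Longrightarrow> t < \<delta> \<Longrightarrow> \<bar>expectation (L t)\<bar> \<le> C"
    using mean_bounded_near_0 by blast
  then have "expectation (L t) = t * expectation (L 1)"
    using \<open>0 \<le> t\<close> expectation_L_add
    by (intro additive_bounded_near_0_imp_linear[where f = "\<lambda>t. expectation (L t)"]) auto
  then show ?thesis by (simp add: mean_1)
qed

text \<open>Zero means remove the cross term, so the second moment is additive in time, and the
  variance bound on \<open>[0, 1]\<close> supplies the boundedness near 0.\<close>

lemma expectation_square_L:
  assumes "0 \<le> t"
  shows "expectation (\<lambda>\<omega>. (L t \<omega>)\<^sup>2) = t * expectation (\<lambda>\<omega>. (L 1 \<omega>)\<^sup>2)"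
proof (rule additive_bounded_near_0_imp_linear[where f = "\<lambda>t. expectation (\<lambda>\<omega>. (L t \<omega>)\<^sup>2)"])
  show "0 \<le> t" by fact
  show "(0::real) < 1" by simp
  show "expectation (\<lambda>\<omega>. (L (s + t) \<omega>)\<^sup>2) =
      expectation (\<lambda>\<omega>. (L s \<omega>)\<^sup>2) + expectation (\<lambda>\<omega>. (L t \<omega>)\<^sup>2)" if "0 \<le> s" "0 \<le> t" for s t
    using expectation_square_L_add[OF that] expectation_L that by simp
  show "\<bar>expectation (\<lambda>\<omega>. (L t \<omega>)\<^sup>2)\<bar> \<le> expectation (\<lambda>\<omega>. (L 1 \<omega>)\<^sup>2)" if "0 \<le> t" "t < 1" for t
    using variance_L_le[of t] that by (simp add: expectation_L)
qed

lemma covariance_L: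
  assumes "0 \<le> s" "0 \<le> t"
  shows "expectation (\<lambda>\<omega>. L s \<omega> * L t \<omega>) = min s t * expectation (\<lambda>\<omega>. (L 1 \<omega>)\<^sup>2)"
proof -
  have *: "expectation (\<lambda>\<omega>. L s \<omega> * L t \<omega>) = s * expectation (\<lambda>\<omega>. (L 1 \<omega>)\<^sup>2)" if "0 \<le> s" "s \<le> t" for s t
  proof -
    have "expectation (\<lambda>\<omega>. L s \<omega> * (L t \<omega> - L s \<omega>)) = 0"
      using expectation_indep_mult[of s "t - s"] that expectation_L by simp
    also have "expectation (\<lambda>\<omega>. L s \<omega> * (L t \<omega> - L s \<omega>)) =
        expectation (\<lambda>\<omega>. L s \<omega> * L t \<omega>) - expectation (\<lambda>\<omega>. (L s \<omega>)\<^sup>2)"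
      using that integrable_mult_L[of s t] integrable_mult_L[of s s]
      by (simp add: right_diff_distrib power2_eq_square)
    finally show ?thesis using expectation_square_L[of s] that by linarith
  qed
  show ?thesis
  proof (cases "s \<le> t")
    case True
    then show ?thesis using *[of s t] assms by (simp add: min_def)
  next
    case False
    then have "expectation (\<lambda>\<omega>. L t \<omega> * L s \<omega>) = min s t * expectation (\<lambda>\<omega>. (L 1 \<omega>)\<^sup>2)"
      using *[of t s] assms by (simp add: min_def)
    moreover have "(\<lambda>\<omega>. L s \<omega> * L t \<omega>) = (\<lambda>\<omega>. L t \<omega> * L s \<omega>)"
      by (simp add: mult.commute)
    ultimately show ?thesis by simp
  qed
qed

end

section \<open>Isometry for the integral\<close>

text \<open>Finite linear combinations of values of the process, paired with the deterministic
  integrands that they are the integrals of.\<close>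

inductive elementary_integral ::
  "(real \<Rightarrow> 'a \<Rightarrow> real) \<Rightarrow> ('a \<Rightarrow> real) \<Rightarrow> (real \<Rightarrow> real) \<Rightarrow> bool" for L
where
  level: "0 \<le> t \<Longrightarrow> elementary_integral L (L t) (indicator {0<..t})"
| add: "elementary_integral L X \<phi> \<Longrightarrow> elementary_integral L Z \<psi> \<Longrightarrow>
    elementary_integral L (\<lambda>\<omega>. X \<omega> + Z \<omega>) (\<lambda>u. \<phi> u + \<psi> u)"
| scale: "elementary_integral L X \<phi> \<Longrightarrow> elementary_integral L (\<lambda>\<omega>. c * X \<omega>) (\<lambda>u. c * \<phi> u)"

lemma elementary_integral_diff:
  assumes "elementary_integral L X \<phi>" "elementary_integral L Z \<psi>"
  shows "elementary_integral L (\<lambda>\<omega>. X \<omega> - Z \<omega>) (\<lambda>u. \<phi> u - \<psi> u)"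
  using elementary_integral.add[OF assms(1) elementary_integral.scale[OF assms(2), of "-1"]]
  by simp

text \<open>The generators provide only intervals starting at 0; a cell of the partition is a
  difference of two of them because its end points are nonnegative and ordered.\<close>

lemma elementary_integral_step:
  assumes "\<And>i. i \<le> n \<Longrightarrow> 0 \<le> ts i" "\<And>i. i < n \<Longrightarrow> ts i \<le> ts (Suc i)"
  shows "elementary_integral L (step_int L n ts a) (step_fun n ts a)"
  using assms
proof (induction n)
  case 0
  \<comment> \<open>No rule produces zero directly, so it is taken as \<open>0\<close> times
    \<open>L 0\<close>.\<close>
  have "elementary_integral L (\<lambda>\<omega>. 0 * L 0 \<omega>) (\<lambda>u. 0 * indicator {0<..0} u)"
    by (intro elementary_integral.intros) simp
  then show ?case by (simp add: step_int_def[abs_def] step_fun_def[abs_def])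
next
  case (Suc n)
  have "elementary_integral L
      (\<lambda>\<omega>. step_int L n ts a \<omega> + a n * (L (ts (Suc n)) \<omega> - L (ts n) \<omega>))
      (\<lambda>u. step_fun n ts a u + a n * (indicator {0<..ts (Suc n)} u - indicator {0<..ts n} u))"
    using Suc by (intro elementary_integral.add elementary_integral.scale elementary_integral_diff
      elementary_integral.level) auto
  moreover have "indicator {0<..ts (Suc n)} u - indicator {0<..ts n} u =
      (indicator {ts n<..ts (Suc n)} u :: real)" for u
    using Suc.prems(1)[of n] Suc.prems(2)[of n] by (auto simp: indicator_def)
  moreover have "step_fun (Suc n) ts a = (\<lambda>u. step_fun n ts a u + a n * indicator {ts n<..ts (Suc n)} u)"
    by (rule ext) (simp only: step_fun_def sum.lessThan_Suc)
  moreover have "step_int L (Suc n) ts a =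
      (\<lambda>\<omega>. step_int L n ts a \<omega> + a n * (L (ts (Suc n)) \<omega> - L (ts n) \<omega>))"
    by (rule ext) (simp only: step_int_def sum.lessThan_Suc)
  ultimately show ?case by simp
qed

context centred_L2_levy
begin

abbreviation "\<sigma>2 \<equiv> expectation (\<lambda>\<omega>. (L 1 \<omega>)\<^sup>2)"

text \<open>For two generators this is the covariance formula: \<open>min t s\<close> is the length
  of the overlap of \<open>{0<..t}\<close> and \<open>{0<..s}\<close>. Linearity extends it to one
  factor here and to the other in the next lemma, so no common refinement of two partitions is ever
  formed.\<close>

lemma elementary_integral_level_inner:
  assumes "elementary_integral L Z \<psi>" "0 \<le> t"
  shows "integrable M (\<lambda>\<omega>. L t \<omega> * Z \<omega>) \<and> integrable lborel (\<lambda>u. indicator {0<..t} u * \<psi> u) \<and>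
    expectation (\<lambda>\<omega>. L t \<omega> * Z \<omega>) = \<sigma>2 * (LINT u|lborel. indicator {0<..t} u * \<psi> u)"
  using assms(1)
proof induction
  case (level s)
  have "(\<lambda>u. indicator {0<..t} u * indicator {0<..s} u) = (indicator {0<..min t s} :: real \<Rightarrow> real)"
    by (auto simp: indicator_def)
  then show ?case
    using level \<open>0 \<le> t\<close> integrable_mult_L[of t s] covariance_L[of t s]
    by (simp add: integrable_indicator_iff)
next
  case (add X \<phi> Z \<psi>)
  then show ?case by (simp add: distrib_left)
next
  case (scale X \<phi> c)
  have "(\<lambda>\<omega>. L t \<omega> * (c * X \<omega>)) = (\<lambda>\<omega>. c * (L t \<omega> * X \<omega>))"
    "(\<lambda>u. indicator {0<..t} u * (c * \<phi> u)) = (\<lambda>u. c * (indicator {0<..t} u * \<phi> u))"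
    by (simp_all add: mult.left_commute fun_eq_iff)
  with scale show ?case by simp
qed

lemma elementary_integral_inner:
  assumes "elementary_integral L X \<phi>" "elementary_integral L Z \<psi>"
  shows "integrable M (\<lambda>\<omega>. X \<omega> * Z \<omega>) \<and> integrable lborel (\<lambda>u. \<phi> u * \<psi> u) \<and>
    expectation (\<lambda>\<omega>. X \<omega> * Z \<omega>) = \<sigma>2 * (LINT u|lborel. \<phi> u * \<psi> u)"
  using assms(1)
proof induction
  case (level s)
  then show ?case using elementary_integral_level_inner assms(2) by blast
next
  case (add X \<phi> Z \<psi>)
  then show ?case by (simp add: distrib_right distrib_left)
next
  case (scale X \<phi> c)
  then show ?case by (simp add: mult.assoc)
qed

lemma elementary_integral_isometry:
  assumes "elementary_integral L X \<phi>"
  shows "(\<integral>\<^sup>+\<omega>. ennreal ((X \<omega>)\<^sup>2) \<partial>M) = ennreal \<sigma>2 * (\<integral>\<^sup>+u. ennreal ((\<phi> u)\<^sup>2) \<partial>lborel)"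
  using elementary_integral_inner[OF assms assms]
  by (simp add: nn_integral_eq_integral power2_eq_square[symmetric] ennreal_mult)

end

section \<open>From step functions to general integrands\<close>

lemma ennreal_square_add3_le:
  "ennreal ((a + b + c :: real)\<^sup>2) \<le> 3 * (ennreal (a\<^sup>2) + ennreal (b\<^sup>2) + ennreal (c\<^sup>2))"
proof -
  have "0 \<le> (a - b)\<^sup>2 + (b - c)\<^sup>2 + (a - c)\<^sup>2" by simp
  then have "(a + b + c)\<^sup>2 \<le> 3 * (a\<^sup>2 + b\<^sup>2 + c\<^sup>2)"
    by (simp add: power2_eq_square algebra_simps)
  then have "ennreal ((a + b + c)\<^sup>2) \<le> ennreal (3 * (a\<^sup>2 + b\<^sup>2 + c\<^sup>2))"
    by (rule ennreal_leI)
  then show ?thesis by (simp add: ennreal_mult)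
qed

lemma nn_integral_square_add3_le:
  fixes f g h :: "'a \<Rightarrow> real"
  assumes [measurable]: "f \<in> borel_measurable M" "g \<in> borel_measurable M" "h \<in> borel_measurable M"
  shows "(\<integral>\<^sup>+x. ennreal ((f x + g x + h x)\<^sup>2) \<partial>M) \<le>
    3 * ((\<integral>\<^sup>+x. ennreal ((f x)\<^sup>2) \<partial>M) + (\<integral>\<^sup>+x. ennreal ((g x)\<^sup>2) \<partial>M) + (\<integral>\<^sup>+x. ennreal ((h x)\<^sup>2) \<partial>M))"
proof -
  have "(\<integral>\<^sup>+x. ennreal ((f x + g x + h x)\<^sup>2) \<partial>M) \<le>
      (\<integral>\<^sup>+x. 3 * (ennreal ((f x)\<^sup>2) + ennreal ((g x)\<^sup>2) + ennreal ((h x)\<^sup>2)) \<partial>M)"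
    by (intro nn_integral_mono ennreal_square_add3_le)
  also have "\<dots> = 3 * ((\<integral>\<^sup>+x. ennreal ((f x)\<^sup>2) \<partial>M) + (\<integral>\<^sup>+x. ennreal ((g x)\<^sup>2) \<partial>M)
      + (\<integral>\<^sup>+x. ennreal ((h x)\<^sup>2) \<partial>M))"
    by (simp add: nn_integral_cmult nn_integral_add)
  finally show ?thesis .
qed

context centred_L2_levy
begin

text \<open>The definition measures the approximation on \<open>{0..t}\<close> only. Since
  \<open>f\<close> and the step functions vanish elsewhere, the same errors are errors on the whole
  line, which makes integrals with different horizons comparable.\<close>

lemma wiener_integral_approx:
  assumes X: "wiener_integral M L t f X"
    and supp: "\<And>u. u \<notin> {0..t} \<Longrightarrow> f u = 0"
  obtains Z \<phi> where
    "\<forall>k. elementary_integral L (Z k) (\<phi> k) \<and> Z k \<in> borel_measurable M \<and> \<phi> k \<in> borel_measurable borel"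
    "(\<lambda>k. \<integral>\<^sup>+u. ennreal ((f u - \<phi> k u)\<^sup>2) \<partial>lborel) \<longlonglongrightarrow> 0"
    "(\<lambda>k. \<integral>\<^sup>+\<omega>. ennreal ((X \<omega> - Z k \<omega>)\<^sup>2) \<partial>M) \<longlonglongrightarrow> 0"
proof -
  obtain n ts a where
    part: "\<forall>k. ts k 0 = 0 \<and> ts k (n k) = t \<and> (\<forall>i<n k. ts k i \<le> ts k (Suc i))"
    and f: "(\<lambda>k. \<integral>\<^sup>+ s\<in>{0..t}. ennreal ((f s - step_fun (n k) (ts k) (a k) s)\<^sup>2) \<partial>lborel) \<longlonglongrightarrow> 0"
    and Z: "(\<lambda>k. \<integral>\<^sup>+ \<omega>. ennreal ((X \<omega> - step_int L (n k) (ts k) (a k) \<omega>)\<^sup>2) \<partial>M) \<longlonglongrightarrow> 0"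
    using X unfolding wiener_integral_def by blast
  have ts: "ts k 0 = 0" "ts k (n k) = t" "i < n k \<Longrightarrow> ts k i \<le> ts k (Suc i)" for k i
    using part by auto
  have mono: "i \<le> j \<Longrightarrow> j \<le> n k \<Longrightarrow> ts k i \<le> ts k j" for i j k
  proof (induction j)
    case (Suc j)
    then show ?case using ts(3)[of j k] by (cases "i = Suc j") auto
  qed simp
  have nonneg: "0 \<le> ts k i" "ts k i \<le> t" if "i \<le> n k" for i k
    using mono[of 0 i k] mono[of i "n k" k] that ts by auto
  have out: "step_fun (n k) (ts k) (a k) u = 0" if "u \<notin> {0..t}" for k u
    unfolding step_fun_def
  proof (intro sum.neutral ballI)
    fix i assume "i \<in> {..<n k}"
    then show "a k i * indicator {ts k i<..ts k (Suc i)} u = 0"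
      using nonneg[of i k] nonneg[of "Suc i" k] that by (auto simp: indicator_def)
  qed
  have "(\<integral>\<^sup>+ s\<in>{0..t}. ennreal ((f s - step_fun (n k) (ts k) (a k) s)\<^sup>2) \<partial>lborel) =
      (\<integral>\<^sup>+ s. ennreal ((f s - step_fun (n k) (ts k) (a k) s)\<^sup>2) \<partial>lborel)" for k
    using out supp by (intro nn_integral_cong) (auto simp: indicator_def)
  with f have "(\<lambda>k. \<integral>\<^sup>+ s. ennreal ((f s - step_fun (n k) (ts k) (a k) s)\<^sup>2) \<partial>lborel) \<longlonglongrightarrow> 0"
    by simp
  moreover have "step_int L (n k) (ts k) (a k) \<in> borel_measurable M" for k
    unfolding step_int_def[abs_def] by measurable
  moreover have "step_fun (n k) (ts k) (a k) \<in> borel_measurable borel" for k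
    unfolding step_fun_def[abs_def] by measurable
  moreover have "elementary_integral L (step_int L (n k) (ts k) (a k)) (step_fun (n k) (ts k) (a k))" for k
    by (intro elementary_integral_step nonneg ts(3))
  ultimately show ?thesis
    using that[of "\<lambda>k. step_int L (n k) (ts k) (a k)" "\<lambda>k. step_fun (n k) (ts k) (a k)"] Z by blast
qed

text \<open>Exact isometry would give the constant 1. Inserting the approximations by the three-term
  square inequality, once for random variables and once for integrands, costs
  \<open>3 * 3 = 9\<close>. In exchange everything stays an inequality in \<open>ennreal\<close>,
  valid for any approximating sequences, even if the right-hand side is infinite.\<close>

lemma wiener_integral_diff_bound:
  assumes X: "wiener_integral M L t f X" "\<And>u. u \<notin> {0..t} \<Longrightarrow> f u = 0"
    and X': "wiener_integral M L s g X'" "\<And>u. u \<notin> {0..s} \<Longrightarrow> g u = 0"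
    and [measurable]: "f \<in> borel_measurable borel" "g \<in> borel_measurable borel"
  shows "(\<integral>\<^sup>+\<omega>. ennreal ((X \<omega> - X' \<omega>)\<^sup>2) \<partial>M) \<le>
    9 * (ennreal \<sigma>2 * (\<integral>\<^sup>+u. ennreal ((f u - g u)\<^sup>2) \<partial>lborel))"
proof -
  have [measurable]: "X \<in> borel_measurable M" "X' \<in> borel_measurable M"
    using X X' by (auto simp: wiener_integral_def)
  obtain Z \<phi> where elem: "\<forall>k. elementary_integral L (Z k) (\<phi> k) \<and>
      Z k \<in> borel_measurable M \<and> \<phi> k \<in> borel_measurable borel"
    and \<phi>: "(\<lambda>k. \<integral>\<^sup>+u. ennreal ((f u - \<phi> k u)\<^sup>2) \<partial>lborel) \<longlonglongrightarrow> 0"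
    and XZ: "(\<lambda>k. \<integral>\<^sup>+\<omega>. ennreal ((X \<omega> - Z k \<omega>)\<^sup>2) \<partial>M) \<longlonglongrightarrow> 0"
    by (rule wiener_integral_approx[OF X])
  have Z: "elementary_integral L (Z k) (\<phi> k)"
    and [measurable]: "Z k \<in> borel_measurable M" "\<phi> k \<in> borel_measurable borel" for k
    using elem by auto
  obtain Z' \<phi>' where elem': "\<forall>k. elementary_integral L (Z' k) (\<phi>' k) \<and>
      Z' k \<in> borel_measurable M \<and> \<phi>' k \<in> borel_measurable borel"
    and \<phi>': "(\<lambda>k. \<integral>\<^sup>+u. ennreal ((g u - \<phi>' k u)\<^sup>2) \<partial>lborel) \<longlonglongrightarrow> 0"
    and XZ': "(\<lambda>k. \<integral>\<^sup>+\<omega>. ennreal ((X' \<omega> - Z' k \<omega>)\<^sup>2) \<partial>M) \<longlonglongrightarrow> 0"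
    by (rule wiener_integral_approx[OF X'])
  have Z': "elementary_integral L (Z' k) (\<phi>' k)"
    and [measurable]: "Z' k \<in> borel_measurable M" "\<phi>' k \<in> borel_measurable borel" for k
    using elem' by auto
  let ?a = "\<lambda>k. \<integral>\<^sup>+\<omega>. ennreal ((X \<omega> - Z k \<omega>)\<^sup>2) \<partial>M"
  let ?a' = "\<lambda>k. \<integral>\<^sup>+\<omega>. ennreal ((X' \<omega> - Z' k \<omega>)\<^sup>2) \<partial>M"
  let ?b = "\<lambda>k. \<integral>\<^sup>+u. ennreal ((f u - \<phi> k u)\<^sup>2) \<partial>lborel"
  let ?b' = "\<lambda>k. \<integral>\<^sup>+u. ennreal ((g u - \<phi>' k u)\<^sup>2) \<partial>lborel"
  let ?D = "\<integral>\<^sup>+u. ennreal ((f u - g u)\<^sup>2) \<partial>lborel"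
  have bound: "(\<integral>\<^sup>+\<omega>. ennreal ((X \<omega> - X' \<omega>)\<^sup>2) \<partial>M) \<le>
    3 * (?a k + ennreal \<sigma>2 * (3 * (?b k + ?D + ?b' k)) + ?a' k)" for k
  proof -
    have "(\<integral>\<^sup>+\<omega>. ennreal ((X \<omega> - X' \<omega>)\<^sup>2) \<partial>M) =
        (\<integral>\<^sup>+\<omega>. ennreal (((X \<omega> - Z k \<omega>) + (Z k \<omega> - Z' k \<omega>) + (Z' k \<omega> - X' \<omega>))\<^sup>2) \<partial>M)"
      by simp
    also have "\<dots> \<le> 3 * (?a k + (\<integral>\<^sup>+\<omega>. ennreal ((Z k \<omega> - Z' k \<omega>)\<^sup>2) \<partial>M)
        + (\<integral>\<^sup>+\<omega>. ennreal ((Z' k \<omega> - X' \<omega>)\<^sup>2) \<partial>M))"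
      by (intro nn_integral_square_add3_le) auto
    also have "(\<integral>\<^sup>+\<omega>. ennreal ((Z' k \<omega> - X' \<omega>)\<^sup>2) \<partial>M) = ?a' k"
      by (intro nn_integral_cong) (simp add: power2_commute)
    also have "(\<integral>\<^sup>+\<omega>. ennreal ((Z k \<omega> - Z' k \<omega>)\<^sup>2) \<partial>M) =
        ennreal \<sigma>2 * (\<integral>\<^sup>+u. ennreal ((\<phi> k u - \<phi>' k u)\<^sup>2) \<partial>lborel)"
      by (intro elementary_integral_isometry elementary_integral_diff Z Z')
    also have "(\<integral>\<^sup>+u. ennreal ((\<phi> k u - \<phi>' k u)\<^sup>2) \<partial>lborel) =
        (\<integral>\<^sup>+u. ennreal (((\<phi> k u - f u) + (f u - g u) + (g u - \<phi>' k u))\<^sup>2) \<partial>lborel)"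
      by simp
    also have "\<dots> \<le> 3 * ((\<integral>\<^sup>+u. ennreal ((\<phi> k u - f u)\<^sup>2) \<partial>lborel) + ?D + ?b' k)"
      by (intro nn_integral_square_add3_le) auto
    also have "(\<integral>\<^sup>+u. ennreal ((\<phi> k u - f u)\<^sup>2) \<partial>lborel) = ?b k"
      by (intro nn_integral_cong) (simp add: power2_commute)
    finally show ?thesis by (simp add: mult_left_mono add_mono)
  qed
  have "(\<lambda>k. 3 * (?a k + ennreal \<sigma>2 * (3 * (?b k + ?D + ?b' k)) + ?a' k))
      \<longlonglongrightarrow> 3 * (0 + ennreal \<sigma>2 * (3 * (0 + ?D + 0)) + 0)"
    by (intro tendsto_add ennreal_tendsto_cmult \<phi> \<phi>' XZ XZ' tendsto_const)
       auto
  then have "(\<integral>\<^sup>+\<omega>. ennreal ((X \<omega> - X' \<omega>)\<^sup>2) \<partial>M) \<le> 3 * (0 + ennreal \<sigma>2 * (3 * (0 + ?D + 0)) + 0)"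
    by (rule LIMSEQ_le_const) (use bound in blast)
  also have "\<dots> = 9 * (ennreal \<sigma>2 * ?D)"
  proof -
    have "3 * (ennreal \<sigma>2 * (3 * ?D)) = (3 * 3) * (ennreal \<sigma>2 * ?D)" by (simp only: mult_ac)
    then show ?thesis by simp
  qed
  finally show ?thesis .
qed

end

section \<open>The Molchan--Golosov kernel\<close>

text \<open>For \<open>u = a\<close> and \<open>\<beta> < 1\<close> the integrand blows up at the
  left end point, but its antiderivative stays continuous there because \<open>\<beta> > 0\<close>.
  The fundamental theorem for nonnegative integrands with one-sided limits then gives integrability
  and value together.\<close>

lemma shifted_power_FTC:
  fixes a b u \<beta> :: real
  assumes "0 < \<beta>" "u \<le> a" "a < b"
  shows "set_integrable lborel {a<..<b} (\<lambda>v. (v - u) powr (\<beta> - 1))"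
    "(LINT v:{a<..<b}|lborel. (v - u) powr (\<beta> - 1)) = ((b - u) powr \<beta> - (a - u) powr \<beta>) / \<beta>"
proof -
  define F where "F v = (v - u) powr \<beta> / \<beta>" for v
  have lim: "(F \<longlongrightarrow> F x) (at x within {a..b})" if "x \<in> {a..b}" for x
  proof -
    have "\<forall>\<^sub>F v in at x within {a..b}. 0 \<le> v - u"
      using assms by (auto simp: eventually_at_filter)
    then show ?thesis
      unfolding F_def using assms
      by (intro tendsto_divide tendsto_powr' tendsto_intros) (auto intro: tendsto_intros)
  qed
  have right: "((F \<circ> real_of_ereal) \<longlongrightarrow> F a) (at_right (ereal a))"
    using lim[of a] assms by (simp add: ereal_tendsto_simps at_within_Icc_at_right)
  have left: "((F \<circ> real_of_ereal) \<longlongrightarrow> F b) (at_left (ereal b))"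
    using lim[of b] assms by (simp add: ereal_tendsto_simps at_within_Icc_at_left)
  have deriv: "DERIV F x :> (x - u) powr (\<beta> - 1)" if "ereal a < ereal x" "ereal x < ereal b" for x
    unfolding F_def using that assms by (auto intro!: derivative_eq_intros)
  have cont: "isCont (\<lambda>v. (v - u) powr (\<beta> - 1)) x" if "ereal a < ereal x" "ereal x < ereal b" for x
    using that assms by (intro continuous_intros) auto
  have "ereal a < ereal b" using assms by simp
  note FTC = interval_integral_FTC_nonneg[OF this deriv cont _ right left]
  show "set_integrable lborel {a<..<b} (\<lambda>v. (v - u) powr (\<beta> - 1))"
    using FTC(1) by (simp add: einterval_eq)
  show "(LINT v:{a<..<b}|lborel. (v - u) powr (\<beta> - 1)) = ((b - u) powr \<beta> - (a - u) powr \<beta>) / \<beta>"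
    using FTC(2) assms by (simp add: interval_lebesgue_integral_le_eq einterval_eq F_def diff_divide_distrib)
qed

lemma nn_integral_power:
  fixes a b \<beta> :: real
  assumes "0 < \<beta>" "0 \<le> a" "a < b"
  shows "(\<integral>\<^sup>+u\<in>{a<..<b}. ennreal (u powr (\<beta> - 1)) \<partial>lborel) = ennreal ((b powr \<beta> - a powr \<beta>) / \<beta>)"
proof -
  have "(\<integral>\<^sup>+u\<in>{a<..<b}. ennreal (u powr (\<beta> - 1)) \<partial>lborel) =
      (\<integral>\<^sup>+u. ennreal (indicator {a<..<b} u *\<^sub>R u powr (\<beta> - 1)) \<partial>lborel)"
    by (intro nn_integral_cong) (auto simp: indicator_def)
  also have "\<dots> = ennreal (LINT u:{a<..<b}|lborel. u powr (\<beta> - 1))"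
    using shifted_power_FTC(1)[of \<beta> 0 a b] assms
    unfolding set_lebesgue_integral_def set_integrable_def
    by (intro nn_integral_eq_integral) auto
  finally show ?thesis using shifted_power_FTC(2)[of \<beta> 0 a b] assms by simp
qed

lemma nn_integral_reflected_power:
  fixes s \<beta> :: real
  assumes "0 < \<beta>" "0 < s"
  shows "(\<integral>\<^sup>+u\<in>{0<..<s}. ennreal ((s - u) powr (\<beta> - 1)) \<partial>lborel) = ennreal (s powr \<beta> / \<beta>)"
proof -
  have "(\<integral>\<^sup>+u\<in>{0<..<s}. ennreal (u powr (\<beta> - 1)) \<partial>lborel) =
      (\<integral>\<^sup>+u. ennreal ((s - u) powr (\<beta> - 1)) * indicator {0<..<s} (s - u) \<partial>lborel)"
    using nn_integral_real_affine[of "\<lambda>u. ennreal (u powr (\<beta> - 1)) * indicator {0<..<s} u" "-1" s]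
    by simp
  also have "\<dots> = (\<integral>\<^sup>+u\<in>{0<..<s}. ennreal ((s - u) powr (\<beta> - 1)) \<partial>lborel)"
    by (intro nn_integral_cong) (auto simp: indicator_def)
  finally show ?thesis using nn_integral_power[of \<beta> 0 s] assms by simp
qed

text \<open>By scaling, the integral is a Beta function value times
  \<open>s powr (- \<alpha>)\<close>; only an upper bound is wanted. Left of \<open>s / 2\<close>
  the factor in \<open>s - u\<close> is at most its value at the midpoint, right of it the factor in
  \<open>u\<close> is, and the remaining power is integrable because
  \<open>0 < \<alpha> < 1/2\<close>.\<close>

lemma nn_integral_beta_bound:
  fixes s \<alpha> :: real
  assumes "0 < \<alpha>" "\<alpha> < 1/2" "0 < s"
  shows "(\<integral>\<^sup>+u\<in>{0<..<s}. ennreal (u powr (- 2 * \<alpha>) * (s - u) powr (\<alpha> - 1)) \<partial>lborel)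
    \<le> ennreal ((2 / (1 - 2 * \<alpha>) + 2 / \<alpha>) * s powr (- \<alpha>))"
proof -
  have pt: "u powr (- 2 * \<alpha>) * (s - u) powr (\<alpha> - 1) \<le>
      (s / 2) powr (\<alpha> - 1) * u powr ((1 - 2 * \<alpha>) - 1) + (s / 2) powr (- 2 * \<alpha>) * (s - u) powr (\<alpha> - 1)"
    if "0 < u" "u < s" for u
  proof (cases "u \<le> s / 2")
    case True
    then have "(s - u) powr (\<alpha> - 1) \<le> (s / 2) powr (\<alpha> - 1)"
      using assms that by (intro powr_mono2') auto
    then have "(s - u) powr (\<alpha> - 1) * u powr (- 2 * \<alpha>) \<le> (s / 2) powr (\<alpha> - 1) * u powr (- 2 * \<alpha>)"
      by (intro mult_right_mono) auto
    then show ?thesis by (simp add: mult.commute add_increasing2)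
  next
    case False
    then have "u powr (- 2 * \<alpha>) \<le> (s / 2) powr (- 2 * \<alpha>)"
      using assms that by (intro powr_mono2') auto
    then have "u powr (- 2 * \<alpha>) * (s - u) powr (\<alpha> - 1) \<le> (s / 2) powr (- 2 * \<alpha>) * (s - u) powr (\<alpha> - 1)"
      by (intro mult_right_mono) auto
    then show ?thesis by (simp add: add_increasing)
  qed
  have "(\<integral>\<^sup>+u\<in>{0<..<s}. ennreal (u powr (- 2 * \<alpha>) * (s - u) powr (\<alpha> - 1)) \<partial>lborel) \<le>
      (\<integral>\<^sup>+u. ennreal ((s / 2) powr (\<alpha> - 1)) * (ennreal (u powr ((1 - 2 * \<alpha>) - 1)) * indicator {0<..<s} u)
        + ennreal ((s / 2) powr (- 2 * \<alpha>)) * (ennreal ((s - u) powr (\<alpha> - 1)) * indicator {0<..<s} u) \<partial>lborel)"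
  proof (intro nn_integral_mono)
    fix u
    show "ennreal (u powr (- 2 * \<alpha>) * (s - u) powr (\<alpha> - 1)) * indicator {0<..<s} u \<le>
      ennreal ((s / 2) powr (\<alpha> - 1)) * (ennreal (u powr ((1 - 2 * \<alpha>) - 1)) * indicator {0<..<s} u)
        + ennreal ((s / 2) powr (- 2 * \<alpha>)) * (ennreal ((s - u) powr (\<alpha> - 1)) * indicator {0<..<s} u)"
    proof (cases "0 < u \<and> u < s")
      case True
      then have "ennreal (u powr (- 2 * \<alpha>) * (s - u) powr (\<alpha> - 1)) \<le> ennreal (
          (s / 2) powr (\<alpha> - 1) * u powr ((1 - 2 * \<alpha>) - 1) + (s / 2) powr (- 2 * \<alpha>) * (s - u) powr (\<alpha> - 1))"
        by (intro ennreal_leI pt) auto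
      then show ?thesis using True by (simp add: ennreal_plus ennreal_mult)
    qed auto
  qed
  also have "\<dots> = ennreal ((s / 2) powr (\<alpha> - 1)) * ennreal (s powr (1 - 2 * \<alpha>) / (1 - 2 * \<alpha>))
      + ennreal ((s / 2) powr (- 2 * \<alpha>)) * ennreal (s powr \<alpha> / \<alpha>)"
    using nn_integral_power[of "1 - 2 * \<alpha>" 0 s] nn_integral_reflected_power[of \<alpha> s] assms
    by (simp add: nn_integral_add nn_integral_cmult)
  also have "\<dots> = ennreal ((s / 2) powr (\<alpha> - 1) * (s powr (1 - 2 * \<alpha>) / (1 - 2 * \<alpha>))
      + (s / 2) powr (- 2 * \<alpha>) * (s powr \<alpha> / \<alpha>))"
    using assms by (simp add: ennreal_plus[symmetric] ennreal_mult[symmetric] del: ennreal_plus)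
  also have "\<dots> \<le> ennreal ((2 / (1 - 2 * \<alpha>) + 2 / \<alpha>) * s powr (- \<alpha>))"
  proof (intro ennreal_leI)
    \<comment> \<open>Used with \<open>e = 1 - \<alpha>\<close> and \<open>e = 2 * \<alpha>\<close>,
      both in \<open>[0, 1]\<close>: halving the base costs at most a factor 2.\<close>
    have half: "(s / 2) powr (- e) \<le> 2 * s powr (- e)" if "0 \<le> e" "e \<le> 1" for e
    proof -
      have "(2::real) powr e \<le> 2 powr 1" using that by (intro powr_mono) auto
      then show ?thesis using assms by (simp add: powr_divide powr_minus field_simps)
    qed
    have "(s / 2) powr (\<alpha> - 1) * s powr (1 - 2 * \<alpha>) \<le> 2 * s powr (\<alpha> - 1) * s powr (1 - 2 * \<alpha>)"
      using half[of "1 - \<alpha>"] assms by (intro mult_right_mono) auto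
    also have "\<dots> = 2 * s powr (- \<alpha>)"
      using assms by (simp add: mult.assoc powr_add[symmetric])
    finally have 1: "(s / 2) powr (\<alpha> - 1) * (s powr (1 - 2 * \<alpha>) / (1 - 2 * \<alpha>)) \<le> 2 / (1 - 2 * \<alpha>) * s powr (- \<alpha>)"
      using assms by (simp add: divide_right_mono)
    have "(s / 2) powr (- 2 * \<alpha>) * s powr \<alpha> \<le> 2 * s powr (- 2 * \<alpha>) * s powr \<alpha>"
      using half[of "2 * \<alpha>"] assms by (intro mult_right_mono) auto
    also have "\<dots> = 2 * s powr (- \<alpha>)"
      using assms by (simp add: mult.assoc powr_add[symmetric])
    finally have 2: "(s / 2) powr (- 2 * \<alpha>) * (s powr \<alpha> / \<alpha>) \<le> 2 / \<alpha> * s powr (- \<alpha>)"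
      using assms by (simp add: divide_right_mono)
    from 1 2 show "(s / 2) powr (\<alpha> - 1) * (s powr (1 - 2 * \<alpha>) / (1 - 2 * \<alpha>))
      + (s / 2) powr (- 2 * \<alpha>) * (s powr \<alpha> / \<alpha>) \<le> (2 / (1 - 2 * \<alpha>) + 2 / \<alpha>) * s powr (- \<alpha>)"
      by (simp add: distrib_right)
  qed
  finally show ?thesis .
qed

text \<open>Both follow from \<open>y powr \<alpha> = y * y powr (\<alpha> - 1)\<close>, whose last
  factor is decreasing in \<open>y\<close>. The first bound survives \<open>x\<close> tending to 0;
  the second is linear in \<open>h\<close>.\<close>

lemma powr_increment_bounds:
  fixes x h \<alpha> :: real
  assumes "0 \<le> x" "0 < h" "0 < \<alpha>" "\<alpha> < 1"
  shows "(x + h) powr \<alpha> - x powr \<alpha> \<le> h powr \<alpha>"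
    and "0 < x \<Longrightarrow> (x + h) powr \<alpha> - x powr \<alpha> \<le> h * x powr (\<alpha> - 1)"
proof -
  have split: "y powr \<alpha> = y * y powr (\<alpha> - 1)" if "0 < y" for y
    using that by (simp add: powr_diff)
  have eq: "(x + h) powr \<alpha> = x * (x + h) powr (\<alpha> - 1) + h * (x + h) powr (\<alpha> - 1)"
    using split[of "x + h"] assms by (simp add: distrib_right)
  have x: "x * (x + h) powr (\<alpha> - 1) \<le> x powr \<alpha>"
  proof (cases "x = 0")
    case False
    then have "(x + h) powr (\<alpha> - 1) \<le> x powr (\<alpha> - 1)"
      using assms by (intro powr_mono2') auto
    then show ?thesis using split[of x] False assms by (simp add: mult_left_mono)
  qed simp
  have "(x + h) powr (\<alpha> - 1) \<le> h powr (\<alpha> - 1)"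
    using assms by (intro powr_mono2') auto
  then have "h * (x + h) powr (\<alpha> - 1) \<le> h powr \<alpha>"
    using split[of h] assms by (simp add: mult_left_mono)
  with eq x show "(x + h) powr \<alpha> - x powr \<alpha> \<le> h powr \<alpha>" by linarith
  assume "0 < x"
  then have "(x + h) powr (\<alpha> - 1) \<le> x powr (\<alpha> - 1)"
    using assms by (intro powr_mono2') auto
  then have "h * (x + h) powr (\<alpha> - 1) \<le> h * x powr (\<alpha> - 1)"
    using assms by (simp add: mult_left_mono)
  with eq x show "(x + h) powr \<alpha> - x powr \<alpha> \<le> h * x powr (\<alpha> - 1)" by linarith
qed

text \<open>Replacing \<open>v powr \<alpha>\<close> by its value at the right end leaves a pure
  shifted power, which serves as integrable majorant and has an explicit integral.\<close>

lemma kernel_integral: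
  fixes a b u \<alpha> :: real
  assumes "0 < \<alpha>" "0 \<le> u" "u \<le> a" "a < b"
  shows kernel_integrable:
      "set_integrable lborel {a<..<b} (\<lambda>v. v powr \<alpha> * (v - u) powr (\<alpha> - 1))" (is ?int)
    and kernel_integral_nonneg:
      "0 \<le> (LINT v:{a<..<b}|lborel. v powr \<alpha> * (v - u) powr (\<alpha> - 1))"
    and kernel_integral_le:
      "(LINT v:{a<..<b}|lborel. v powr \<alpha> * (v - u) powr (\<alpha> - 1))
        \<le> b powr \<alpha> * (((b - u) powr \<alpha> - (a - u) powr \<alpha>) / \<alpha>)"
proof -
  have le: "v powr \<alpha> * (v - u) powr (\<alpha> - 1) \<le> b powr \<alpha> * (v - u) powr (\<alpha> - 1)" if "v \<in> {a<..<b}" for v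
    using that assms by (intro mult_right_mono powr_mono2) auto
  have bound: "set_integrable lborel {a<..<b} (\<lambda>v. b powr \<alpha> * (v - u) powr (\<alpha> - 1))"
    using shifted_power_FTC(1)[of \<alpha> u a b] assms by simp
  show int: ?int
  proof (rule set_integrable_bound[OF bound])
    show "AE v in lborel. v \<in> {a<..<b} \<longrightarrow>
        norm (v powr \<alpha> * (v - u) powr (\<alpha> - 1)) \<le> norm (b powr \<alpha> * (v - u) powr (\<alpha> - 1))"
      using le by (intro AE_I2) auto
  qed (simp add: set_borel_measurable_def)
  show "0 \<le> (LINT v:{a<..<b}|lborel. v powr \<alpha> * (v - u) powr (\<alpha> - 1))"
    unfolding set_lebesgue_integral_def by (intro integral_nonneg_AE AE_I2) auto
  have "(LINT v:{a<..<b}|lborel. v powr \<alpha> * (v - u) powr (\<alpha> - 1)) \<le>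
      (LINT v:{a<..<b}|lborel. b powr \<alpha> * (v - u) powr (\<alpha> - 1))"
    by (rule set_integral_mono[OF int bound le])
  then show "(LINT v:{a<..<b}|lborel. v powr \<alpha> * (v - u) powr (\<alpha> - 1))
        \<le> b powr \<alpha> * (((b - u) powr \<alpha> - (a - u) powr \<alpha>) / \<alpha>)"
    using shifted_power_FTC(2)[of \<alpha> u a b] assms by simp
qed

section \<open>Pointwise and integrated increments of the kernel\<close>

lemma zH_eq:
  assumes "0 < s" "s < t"
  shows "zH H t s = (H - 1/2) * cH H * s powr (- (H - 1/2)) *
    (LINT v:{s<..<t}|lborel. v powr (H - 1/2) * (v - s) powr ((H - 1/2) - 1))"
  using assms by (simp add: zH_def interval_lebesgue_integral_le_eq einterval_eq)

lemma measurable_zH [measurable]: "zH H t \<in> borel_measurable borel"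
proof -
  \<comment> \<open>The domain of integration depends on \<open>s\<close>; moving it into the
    integrand reduces the claim to joint measurability in \<open>s\<close> and
    \<open>v\<close>.\<close>
  have "(\<lambda>s. LINT v|lborel. (if s < v \<and> v < t then v powr (H - 1/2) * (v - s) powr ((H - 1/2) - 1) else 0))
      \<in> borel_measurable borel"
    by measurable
  moreover have "zH H t = (\<lambda>s. if 0 < s \<and> s < t then (H - 1/2) * cH H * s powr (- (H - 1/2)) *
    (LINT v|lborel. (if s < v \<and> v < t then v powr (H - 1/2) * (v - s) powr ((H - 1/2) - 1) else 0)) else 0)"
  proof
    fix s
    show "zH H t s = (if 0 < s \<and> s < t then (H - 1/2) * cH H * s powr (- (H - 1/2)) *
      (LINT v|lborel. (if s < v \<and> v < t then v powr (H - 1/2) * (v - s) powr ((H - 1/2) - 1) else 0)) else 0)"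
    proof (cases "0 < s \<and> s < t")
      case True
      have "(LINT v:{s<..<t}|lborel. v powr (H - 1/2) * (v - s) powr ((H - 1/2) - 1)) =
          (LINT v|lborel. (if s < v \<and> v < t then v powr (H - 1/2) * (v - s) powr ((H - 1/2) - 1) else 0))"
        unfolding set_lebesgue_integral_def
        by (intro Bochner_Integration.integral_cong) (auto simp: indicator_def)
      then show ?thesis using True by (simp add: zH_eq)
    qed (auto simp: zH_def)
  qed
  ultimately show ?thesis by simp
qed

text \<open>The prefactor does not involve the time argument, so subtracting the kernel at time
  \<open>s\<close> just removes the part of the integral below \<open>s\<close>. For
  \<open>s \<le> u\<close> that kernel is zero and nothing is removed; \<open>max s u\<close> covers
  both cases.\<close>

lemma zH_diff_eq:
  assumes "1/2 < H" "0 \<le> s" "s < t" "0 < u" "u < t"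
  shows "zH H t u - zH H s u = (H - 1/2) * cH H * u powr (- (H - 1/2)) *
    (LINT v:{max s u<..<t}|lborel. v powr (H - 1/2) * (v - u) powr ((H - 1/2) - 1))"
proof (cases "s \<le> u")
  case True
  then have "zH H s u = 0" by (simp add: zH_def)
  then show ?thesis using True assms by (simp add: zH_eq max_def)
next
  case False
  let ?f = "\<lambda>v. v powr (H - 1/2) * (v - u) powr ((H - 1/2) - 1)"
  have "(LINT v:{u<..<t}|lborel. ?f v) = (LINT v:{u<..<s} \<union> {s<..<t}|lborel. ?f v)"
  proof (rule set_integral_cong_set)
    show "AE x in lborel. (x \<in> {u<..<s} \<union> {s<..<t}) = (x \<in> {u<..<t})"
      using AE_lborel_singleton[of s] by eventually_elim (use False assms in auto)
  qed (auto simp: set_borel_measurable_def)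
  also have "\<dots> = (LINT v:{u<..<s}|lborel. ?f v) + (LINT v:{s<..<t}|lborel. ?f v)"
    using False assms by (intro set_integral_Un kernel_integrable) auto
  finally show ?thesis
    using False assms by (simp add: zH_eq max_def distrib_left)
qed

text \<open>For \<open>u < s\<close> the two power increment bounds are multiplied instead of one
  being squared: the squared linear bound contains \<open>(s - u) powr (2 * \<alpha> - 2)\<close>,
  not integrable at \<open>s\<close> when \<open>H < 1\<close>, whereas the product contains only
  \<open>(s - u) powr (\<alpha> - 1)\<close>. For \<open>u \<ge> s\<close> the bound
  \<open>h powr (2 * \<alpha>)\<close> is enough, because integration over the cell gains another
  power of \<open>h\<close>.\<close>

lemma zH_diff_bound:
  assumes "1/2 < H" "H < 1" and u: "0 \<le> s" "0 < h" "0 < u" "u < s + h"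
  defines "\<alpha> \<equiv> H - 1/2"
  shows "(zH H (s + h) u - zH H s u)\<^sup>2 \<le> (cH H)\<^sup>2 * (s + h) powr (2 * \<alpha>) *
    (u powr (- 2 * \<alpha>) * (if u < s then h powr (1 + \<alpha>) * (s - u) powr (\<alpha> - 1) else h powr (2 * \<alpha>)))"
proof -
  have \<alpha>: "0 < \<alpha>" "\<alpha> < 1" using assms(1,2) by (auto simp: \<alpha>_def)
  define I where "I = (LINT v:{max s u<..<s + h}|lborel. v powr \<alpha> * (v - u) powr (\<alpha> - 1))"
  define G where "G = (s + h - u) powr \<alpha> - (max s u - u) powr \<alpha>"
  have "0 \<le> I" and I_le: "I \<le> (s + h) powr \<alpha> * (G / \<alpha>)"
    unfolding I_def G_def using u \<alpha>
    by (intro kernel_integral_nonneg kernel_integral_le; simp)+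
  have "0 \<le> G" unfolding G_def using u \<alpha> by (auto intro!: powr_mono2)
  have G: "G\<^sup>2 \<le> (if u < s then h powr (1 + \<alpha>) * (s - u) powr (\<alpha> - 1) else h powr (2 * \<alpha>))"
  proof (cases "u < s")
    case True
    then have "G \<le> h powr \<alpha>" "G \<le> h * (s - u) powr (\<alpha> - 1)"
      using powr_increment_bounds[of "s - u" h \<alpha>] u \<alpha>
      by (auto simp: G_def max_def algebra_simps)
    then have "G * G \<le> h powr \<alpha> * (h * (s - u) powr (\<alpha> - 1))"
      using \<open>0 \<le> G\<close> by (intro mult_mono) auto
    then show ?thesis
      using True u by (simp add: power2_eq_square powr_add mult_ac)
  next
    case False
    then have "G \<le> h powr \<alpha>"
      unfolding G_def using u \<alpha> by (auto simp: max_def intro!: powr_mono2)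
    then have "G * G \<le> h powr \<alpha> * h powr \<alpha>"
      using \<open>0 \<le> G\<close> by (intro mult_mono) auto
    then show ?thesis
      using False by (simp add: power2_eq_square powr_add[symmetric])
  qed
  have sq: "(x powr e)\<^sup>2 = x powr (2 * e)" for x e :: real
    by (simp add: power2_eq_square powr_add[symmetric])
  have "(zH H (s + h) u - zH H s u)\<^sup>2 = (\<alpha> * cH H * u powr (- \<alpha>) * I)\<^sup>2"
    using zH_diff_eq[of H s "s + h" u] assms(1) u unfolding I_def \<alpha>_def by simp
  also have "\<dots> = (\<alpha> * cH H * u powr (- \<alpha>))\<^sup>2 * I\<^sup>2"
    by (simp add: power_mult_distrib)
  also have "\<dots> \<le> (\<alpha> * cH H * u powr (- \<alpha>))\<^sup>2 * ((s + h) powr \<alpha> * (G / \<alpha>))\<^sup>2"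
    using \<open>0 \<le> I\<close> I_le by (intro mult_left_mono power_mono) auto
  \<comment> \<open>The factor \<open>\<alpha>\<close> of the kernel cancels the
    \<open>1 / \<alpha>\<close> from integrating the power.\<close>
  also have "\<dots> = (cH H)\<^sup>2 * (s + h) powr (2 * \<alpha>) * (u powr (- 2 * \<alpha>) * G\<^sup>2)"
    using \<alpha> by (simp add: power_mult_distrib power_divide sq)
  also have "\<dots> \<le> (cH H)\<^sup>2 * (s + h) powr (2 * \<alpha>) *
    (u powr (- 2 * \<alpha>) * (if u < s then h powr (1 + \<alpha>) * (s - u) powr (\<alpha> - 1) else h powr (2 * \<alpha>)))"
    using G by (intro mult_left_mono) auto
  finally show ?thesis .
qed

text \<open>On the first cell the powers of \<open>h\<close> combine to exactly \<open>h\<close>,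
  with constant \<open>1 / (1 - 2 * \<alpha>)\<close>. On later cells
  \<open>u powr (- 2 * \<alpha>)\<close> is at most its value at \<open>s\<close>, and
  \<open>(s + h) / s \<le> 2\<close> gives constant 2. The stated constant dominates both.\<close>

lemma powr_times_nn_integral_power_le:
  fixes s h \<alpha> :: real
  assumes "0 < \<alpha>" "\<alpha> < 1/2" "0 < h" "s = 0 \<or> h \<le> s"
  shows "ennreal ((s + h) powr (2 * \<alpha>)) * (\<integral>\<^sup>+u\<in>{s<..<s + h}. ennreal (u powr (- 2 * \<alpha>)) \<partial>lborel)
    \<le> ennreal (2 / (1 - 2 * \<alpha>) * h)"
proof (cases "s = 0")
  case True
  have "(\<integral>\<^sup>+u\<in>{0<..<h}. ennreal (u powr (- 2 * \<alpha>)) \<partial>lborel) = ennreal (h powr (1 - 2 * \<alpha>) / (1 - 2 * \<alpha>))"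
    using nn_integral_power[of "1 - 2 * \<alpha>" 0 h] assms by simp
  then have "ennreal ((s + h) powr (2 * \<alpha>)) * (\<integral>\<^sup>+u\<in>{s<..<s + h}. ennreal (u powr (- 2 * \<alpha>)) \<partial>lborel)
      = ennreal (h powr (2 * \<alpha>) * (h powr (1 - 2 * \<alpha>) / (1 - 2 * \<alpha>)))"
    using True assms by (simp add: ennreal_mult[symmetric])
  also have "h powr (2 * \<alpha>) * (h powr (1 - 2 * \<alpha>) / (1 - 2 * \<alpha>)) = 1 / (1 - 2 * \<alpha>) * h"
    using assms by (simp add: powr_add[symmetric])
  also have "ennreal \<dots> \<le> ennreal (2 / (1 - 2 * \<alpha>) * h)"
    using assms by (intro ennreal_leI mult_right_mono divide_right_mono) auto
  finally show ?thesis .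
next
  case False
  then have s: "0 < s" "h \<le> s" using assms by auto
  have "(\<integral>\<^sup>+u\<in>{s<..<s + h}. ennreal (u powr (- 2 * \<alpha>)) \<partial>lborel) \<le>
      (\<integral>\<^sup>+u\<in>{s<..<s + h}. ennreal (s powr (- 2 * \<alpha>)) \<partial>lborel)"
    using s assms by (intro nn_integral_mono)
      (auto simp: indicator_def intro!: ennreal_leI powr_mono2')
  also have "\<dots> = ennreal (s powr (- 2 * \<alpha>) * h)"
    using assms by (simp add: nn_integral_cmult_indicator ennreal_mult)
  finally have "ennreal ((s + h) powr (2 * \<alpha>)) * (\<integral>\<^sup>+u\<in>{s<..<s + h}. ennreal (u powr (- 2 * \<alpha>)) \<partial>lborel)
      \<le> ennreal ((s + h) powr (2 * \<alpha>)) * ennreal (s powr (- 2 * \<alpha>) * h)"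
    by (rule mult_left_mono) simp
  also have "\<dots> = ennreal ((s + h) powr (2 * \<alpha>) * s powr (- 2 * \<alpha>) * h)"
    using assms by (simp add: ennreal_mult[symmetric] mult.assoc)
  also have "\<dots> \<le> ennreal (2 / (1 - 2 * \<alpha>) * h)"
  proof (intro ennreal_leI mult_right_mono)
    have "(s + h) powr (2 * \<alpha>) * s powr (- 2 * \<alpha>) = ((s + h) / s) powr (2 * \<alpha>)"
      using s assms by (simp add: powr_divide powr_minus field_simps)
    also have "\<dots> \<le> 2 powr (2 * \<alpha>)"
      using s assms by (intro powr_mono2) (auto simp: field_simps)
    also have "\<dots> \<le> 2 powr 1" using assms by (intro powr_mono) auto
    also have "\<dots> \<le> 2 / (1 - 2 * \<alpha>)" using assms by (simp add: field_simps)
    finally show "(s + h) powr (2 * \<alpha>) * s powr (- 2 * \<alpha>) \<le> 2 / (1 - 2 * \<alpha>)" .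
  qed (use assms in auto)
  finally show ?thesis .
qed

text \<open>The Beta bound alone blows up like \<open>s powr (- \<alpha>)\<close> for small
  \<open>s\<close>. Here \<open>s + h \<le> 2 * s\<close> turns the product into at most
  \<open>2 * s powr \<alpha>\<close>, hence a bound uniform in \<open>s\<close>. For
  \<open>s = 0\<close> the domain is empty.\<close>

lemma powr_times_nn_integral_beta_le:
  fixes s h T \<alpha> :: real
  assumes "0 < \<alpha>" "\<alpha> < 1/2" "0 < h" "s = 0 \<or> h \<le> s" "s + h \<le> T"
  shows "ennreal ((s + h) powr (2 * \<alpha>)) *
      (\<integral>\<^sup>+u\<in>{0<..<s}. ennreal (u powr (- 2 * \<alpha>) * (s - u) powr (\<alpha> - 1)) \<partial>lborel)
    \<le> ennreal ((2 / (1 - 2 * \<alpha>) + 2 / \<alpha>) * (2 * T powr \<alpha>))"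
proof (cases "s = 0")
  case True
  then show ?thesis by simp
next
  case False
  then have s: "0 < s" "h \<le> s" using assms by auto
  have "ennreal ((s + h) powr (2 * \<alpha>)) *
      (\<integral>\<^sup>+u\<in>{0<..<s}. ennreal (u powr (- 2 * \<alpha>) * (s - u) powr (\<alpha> - 1)) \<partial>lborel) \<le>
    ennreal ((s + h) powr (2 * \<alpha>)) * ennreal ((2 / (1 - 2 * \<alpha>) + 2 / \<alpha>) * s powr (- \<alpha>))"
    using s assms by (intro mult_left_mono nn_integral_beta_bound) auto
  also have "\<dots> = ennreal ((2 / (1 - 2 * \<alpha>) + 2 / \<alpha>) * ((s + h) powr (2 * \<alpha>) * s powr (- \<alpha>)))"
    using assms by (simp add: ennreal_mult[symmetric] mult_ac)
  also have "\<dots> \<le> ennreal ((2 / (1 - 2 * \<alpha>) + 2 / \<alpha>) * (2 * T powr \<alpha>))"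
  proof (intro ennreal_leI mult_left_mono)
    have "(s + h) powr (2 * \<alpha>) * s powr (- \<alpha>) \<le> (2 * s) powr (2 * \<alpha>) * s powr (- \<alpha>)"
      using s assms by (intro mult_right_mono powr_mono2) auto
    also have "\<dots> = 2 powr (2 * \<alpha>) * s powr \<alpha>"
      using s by (simp add: powr_mult mult.assoc powr_add[symmetric])
    also have "\<dots> \<le> 2 powr 1 * T powr \<alpha>"
      using s assms by (intro mult_mono powr_mono powr_mono2) auto
    finally show "(s + h) powr (2 * \<alpha>) * s powr (- \<alpha>) \<le> 2 * T powr \<alpha>" by simp
  qed (use assms in auto)
  finally show ?thesis .
qed

text \<open>The constant may depend on \<open>T\<close> but not on \<open>s\<close> or
  \<open>h\<close>: \<open>A\<close> collects the contribution of \<open>u < s\<close>, where both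
  kernels are active, and \<open>B\<close> that of the cell itself.\<close>

lemma zH_increment_bound:
  assumes H: "1/2 < H" "H < 1"
  shows "\<exists>C\<ge>0. \<forall>s h. 0 < h \<longrightarrow> (s = 0 \<or> h \<le> s) \<longrightarrow> s + h \<le> T \<longrightarrow>
    (\<integral>\<^sup>+u. ennreal ((zH H (s + h) u - zH H s u)\<^sup>2) \<partial>lborel) \<le> ennreal (C * h powr (H + 1/2))"
proof -
  define \<alpha> where "\<alpha> = H - 1/2"
  have \<alpha>: "0 < \<alpha>" "\<alpha> < 1/2" using H by (auto simp: \<alpha>_def)
  define c where "c = 2 / (1 - 2 * \<alpha>)"
  have c: "0 \<le> c" using \<alpha> by (simp add: c_def)
  define A where "A = (2 / (1 - 2 * \<alpha>) + 2 / \<alpha>) * (2 * T powr \<alpha>)"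
  define B where "B = 2 / (1 - 2 * \<alpha>) * T powr \<alpha>"
  have AB: "0 \<le> A" "0 \<le> B" unfolding A_def B_def using \<alpha> by auto
  have "(\<integral>\<^sup>+u. ennreal ((zH H (s + h) u - zH H s u)\<^sup>2) \<partial>lborel)
      \<le> ennreal ((cH H)\<^sup>2 * (A + B) * h powr (H + 1/2))"
    if h: "0 < h" "s = 0 \<or> h \<le> s" "s + h \<le> T" for s h
  proof -
    have s: "0 \<le> s" using h by auto
    let ?I = "\<integral>\<^sup>+u\<in>{0<..<s}. ennreal (u powr (- 2 * \<alpha>) * (s - u) powr (\<alpha> - 1)) \<partial>lborel"
    let ?J = "\<integral>\<^sup>+u\<in>{s<..<s + h}. ennreal (u powr (- 2 * \<alpha>)) \<partial>lborel"
    let ?c = "ennreal ((cH H)\<^sup>2 * (s + h) powr (2 * \<alpha>))"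
    have "(\<integral>\<^sup>+u. ennreal ((zH H (s + h) u - zH H s u)\<^sup>2) \<partial>lborel) \<le>
        (\<integral>\<^sup>+u. ?c * (ennreal (h powr (1 + \<alpha>)) *
            (ennreal (u powr (- 2 * \<alpha>) * (s - u) powr (\<alpha> - 1)) * indicator {0<..<s} u) +
          ennreal (h powr (2 * \<alpha>)) * (ennreal (u powr (- 2 * \<alpha>)) * indicator {s<..<s + h} u)) \<partial>lborel)"
    proof (rule nn_integral_mono_AE)
      show "AE u in lborel. ennreal ((zH H (s + h) u - zH H s u)\<^sup>2) \<le>
        ?c * (ennreal (h powr (1 + \<alpha>)) *
            (ennreal (u powr (- 2 * \<alpha>) * (s - u) powr (\<alpha> - 1)) * indicator {0<..<s} u) +
          ennreal (h powr (2 * \<alpha>)) * (ennreal (u powr (- 2 * \<alpha>)) * indicator {s<..<s + h} u))"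
        using AE_lborel_singleton[of s]
      proof eventually_elim
        fix u assume "u \<noteq> s"
        consider "u \<le> 0 \<or> s + h \<le> u" | "0 < u" "u < s" | "s < u" "u < s + h"
          using \<open>u \<noteq> s\<close> by linarith
        then show "ennreal ((zH H (s + h) u - zH H s u)\<^sup>2) \<le>
          ?c * (ennreal (h powr (1 + \<alpha>)) *
              (ennreal (u powr (- 2 * \<alpha>) * (s - u) powr (\<alpha> - 1)) * indicator {0<..<s} u) +
            ennreal (h powr (2 * \<alpha>)) * (ennreal (u powr (- 2 * \<alpha>)) * indicator {s<..<s + h} u))"
        proof cases
          case 1
          then have "zH H (s + h) u = 0" "zH H s u = 0"
            using h by (auto simp: zH_def)
          then show ?thesis by simp
        next
          case 2
          then have "(zH H (s + h) u - zH H s u)\<^sup>2 \<le> (cH H)\<^sup>2 * (s + h) powr (2 * \<alpha>) *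
              (u powr (- 2 * \<alpha>) * (h powr (1 + \<alpha>) * (s - u) powr (\<alpha> - 1)))"
            using zH_diff_bound[of H s h u] H s h by (simp add: \<alpha>_def)
          also have "\<dots> = (cH H)\<^sup>2 * (s + h) powr (2 * \<alpha>) *
              (h powr (1 + \<alpha>) * (u powr (- 2 * \<alpha>) * (s - u) powr (\<alpha> - 1)))"
            by (simp only: mult_ac)
          finally show ?thesis
            using 2 by (simp add: ennreal_mult[symmetric])
        next
          case 3
          then have "(zH H (s + h) u - zH H s u)\<^sup>2 \<le> (cH H)\<^sup>2 * (s + h) powr (2 * \<alpha>) *
              (u powr (- 2 * \<alpha>) * h powr (2 * \<alpha>))"
            using zH_diff_bound[of H s h u] H s h by (simp add: \<alpha>_def)
          also have "\<dots> = (cH H)\<^sup>2 * (s + h) powr (2 * \<alpha>) *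
              (h powr (2 * \<alpha>) * u powr (- 2 * \<alpha>))"
            by (simp only: mult_ac)
          finally show ?thesis
            using 3 by (simp add: ennreal_mult[symmetric])
        qed
      qed
    qed
    also have "\<dots> = ?c * (ennreal (h powr (1 + \<alpha>)) * ?I + ennreal (h powr (2 * \<alpha>)) * ?J)"
      by (simp add: nn_integral_cmult nn_integral_add)
    also have "?c = ennreal ((cH H)\<^sup>2) * ennreal ((s + h) powr (2 * \<alpha>))"
      by (simp add: ennreal_mult)
    also have "\<dots> * (ennreal (h powr (1 + \<alpha>)) * ?I + ennreal (h powr (2 * \<alpha>)) * ?J) =
        ennreal ((cH H)\<^sup>2) * (ennreal (h powr (1 + \<alpha>)) * (ennreal ((s + h) powr (2 * \<alpha>)) * ?I)
          + ennreal (h powr (2 * \<alpha>)) * (ennreal ((s + h) powr (2 * \<alpha>)) * ?J))"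
      by (simp only: distrib_left mult_ac)
    also have "\<dots> \<le> ennreal ((cH H)\<^sup>2) * (ennreal (h powr (1 + \<alpha>)) * ennreal A
          + ennreal (h powr (2 * \<alpha>)) * ennreal (2 / (1 - 2 * \<alpha>) * h))"
      unfolding A_def using \<alpha> h
      by (intro mult_left_mono add_mono powr_times_nn_integral_beta_le powr_times_nn_integral_power_le) auto
    also have "\<dots> = ennreal ((cH H)\<^sup>2 * (h powr (1 + \<alpha>) * A + h powr (2 * \<alpha>) * (2 / (1 - 2 * \<alpha>) * h)))"
      using AB \<alpha> h by (simp add: ennreal_plus[symmetric] ennreal_mult[symmetric] del: ennreal_plus)
    also have "\<dots> \<le> ennreal ((cH H)\<^sup>2 * (A + B) * h powr (H + 1/2))"
    proof (intro ennreal_leI)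
      \<comment> \<open>The cell contributes the better power \<open>1 + 2 * \<alpha>\<close>; its
        excess \<open>h powr \<alpha>\<close> is traded for \<open>T powr \<alpha>\<close> to reach
        the common exponent.\<close>
      have "h powr (2 * \<alpha>) * h = h powr (2 * \<alpha> + 1)"
        using h by (simp add: powr_add)
      also have "\<dots> = h powr \<alpha> * h powr (1 + \<alpha>)"
        by (simp add: powr_add[symmetric])
      also have "\<dots> \<le> T powr \<alpha> * h powr (1 + \<alpha>)"
        using h s \<alpha> by (intro mult_right_mono powr_mono2) auto
      finally have "c * (h powr (2 * \<alpha>) * h) \<le> c * (T powr \<alpha> * h powr (1 + \<alpha>))"
        using c by (intro mult_left_mono) auto
      then have "h powr (1 + \<alpha>) * A + h powr (2 * \<alpha>) * (2 / (1 - 2 * \<alpha>) * h) \<le> (A + B) * h powr (1 + \<alpha>)"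
        unfolding B_def c_def[symmetric] by (simp add: algebra_simps)
      then have "(cH H)\<^sup>2 * (h powr (1 + \<alpha>) * A + h powr (2 * \<alpha>) * (2 / (1 - 2 * \<alpha>) * h))
          \<le> (cH H)\<^sup>2 * ((A + B) * h powr (1 + \<alpha>))"
        by (intro mult_left_mono) auto
      moreover have "1 + \<alpha> = H + 1/2" by (simp add: \<alpha>_def)
      ultimately show "(cH H)\<^sup>2 * (h powr (1 + \<alpha>) * A + h powr (2 * \<alpha>) * (2 / (1 - 2 * \<alpha>) * h))
          \<le> (cH H)\<^sup>2 * (A + B) * h powr (H + 1/2)"
        by (simp only: mult.assoc)
    qed
    finally show ?thesis .
  qed
  moreover have "0 \<le> (cH H)\<^sup>2 * (A + B)" using AB by simp
  ultimately show ?thesis by blast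
qed

section \<open>Dyadic sums of squares\<close>

text \<open>Exchanging sum and integral shows that the random series has finite expectation, so it
  converges almost surely and its terms tend to 0.\<close>

lemma AE_tendsto_0_of_summable_nn_integral:
  fixes S :: "nat \<Rightarrow> 'a \<Rightarrow> real"
  assumes [measurable]: "\<And>n. S n \<in> borel_measurable M"
    and nonneg: "\<And>n \<omega>. 0 \<le> S n \<omega>"
    and bound: "\<And>n. (\<integral>\<^sup>+\<omega>. ennreal (S n \<omega>) \<partial>M) \<le> ennreal (b n)"
    and "\<And>n. 0 \<le> b n" "summable b"
  shows "AE \<omega> in M. (\<lambda>n. S n \<omega>) \<longlonglongrightarrow> 0"
proof -
  have "(\<integral>\<^sup>+\<omega>. (\<Sum>n. ennreal (S n \<omega>)) \<partial>M) = (\<Sum>n. \<integral>\<^sup>+\<omega>. ennreal (S n \<omega>) \<partial>M)"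
    by (rule nn_integral_suminf) simp
  also have "\<dots> \<le> (\<Sum>n. ennreal (b n))"
    by (intro suminf_le bound) auto
  also have "\<dots> = ennreal (suminf b)"
    using assms by (intro suminf_ennreal2) auto
  finally have "(\<integral>\<^sup>+\<omega>. (\<Sum>n. ennreal (S n \<omega>)) \<partial>M) \<noteq> \<infinity>"
    by (auto simp: top_unique)
  then have "AE \<omega> in M. (\<Sum>n. ennreal (S n \<omega>)) \<noteq> \<infinity>"
    by (intro nn_integral_PInf_AE) auto
  then show ?thesis
  proof eventually_elim
    case (elim \<omega>)
    then have "summable (\<lambda>n. S n \<omega>)"
      by (intro summable_suminf_not_top nonneg) simp
    then show ?case by (rule summable_LIMSEQ_zero)
  qed
qed

lemma dyadic_powr:
  fixes t e :: real
  assumes "0 < t"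
  shows "2 ^ n * (t / 2 ^ n) powr e = t powr e * (2 powr (1 - e)) ^ n"
proof -
  have "((2::real) ^ n) powr e = (2 powr e) ^ n"
    by (induction n) (simp_all add: powr_mult)
  then have "(t / 2 ^ n) powr e = t powr e / (2 powr e) ^ n"
    using assms powr_divide[of t "2 ^ n" e] by simp
  moreover have "(2 powr (1 - e)) ^ n = 2 ^ n / ((2::real) powr e) ^ n"
    by (simp add: powr_diff power_divide)
  ultimately show ?thesis by simp
qed

theorem mainTheorem6:
  fixes M :: "'a measure" and L Y :: "real \<Rightarrow> 'a \<Rightarrow> real" and H :: real
  assumes "1/2 < H" and "H < 1"
    and "levy_process M L"
    and "no_gaussian_component M L"
    and "integrable M (L 1)"
    and "(\<integral>\<omega>. L 1 \<omega> \<partial>M) = 0"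
    and "integrable M (\<lambda>\<omega>. (L 1 \<omega>)\<^sup>2)"
    and "\<forall>t\<ge>0. wiener_integral M L t (zH H t) (Y t)"
  shows "\<forall>t>0. AE \<omega> in M.
           (\<lambda>n. \<Sum>j=1..2^n. (Y (real j * t / 2^n) \<omega> - Y ((real j - 1) * t / 2^n) \<omega>)\<^sup>2)
             \<longlonglongrightarrow> 0"
proof (intro allI impI)
  fix t :: real assume "0 < t"
  interpret prob_space M using assms(3) by (simp add: levy_process_def)
  interpret centred_L2_levy M L by unfold_locales (use assms in auto)
  have wi: "wiener_integral M L u (zH H u) (Y u)" if "0 \<le> u" for u
    using assms(8) that by blast
  have Y_measurable: "Y u \<in> borel_measurable M" if "0 \<le> u" for u
    using wi[OF that] by (simp add: wiener_integral_def)
  obtain C where "0 \<le> C" and C: "\<And>s h. 0 < h \<Longrightarrow> s = 0 \<or> h \<le> s \<Longrightarrow> s + h \<le> t \<Longrightarrow>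
    (\<integral>\<^sup>+u. ennreal ((zH H (s + h) u - zH H s u)\<^sup>2) \<partial>lborel) \<le> ennreal (C * h powr (H + 1/2))"
    using zH_increment_bound[OF assms(1,2), of t] by blast
  define D where "D = 9 * (\<sigma>2 * C)"
  have "0 \<le> D" unfolding D_def using \<open>0 \<le> C\<close> by simp
  have increment: "(\<integral>\<^sup>+\<omega>. ennreal ((Y (s + h) \<omega> - Y s \<omega>)\<^sup>2) \<partial>M) \<le> ennreal (D * h powr (H + 1/2))"
    if "0 < h" "s = 0 \<or> h \<le> s" "s + h \<le> t" for s h
  proof -
    \<comment> \<open>Each kernel vanishes outside its own time interval, so the integrals with
      horizons \<open>s + h\<close> and \<open>s\<close> can be compared.\<close>
    have "(\<integral>\<^sup>+\<omega>. ennreal ((Y (s + h) \<omega> - Y s \<omega>)\<^sup>2) \<partial>M) \<le>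
        9 * (ennreal \<sigma>2 * (\<integral>\<^sup>+u. ennreal ((zH H (s + h) u - zH H s u)\<^sup>2) \<partial>lborel))"
      using that by (intro wiener_integral_diff_bound[OF wi _ wi] measurable_zH) (auto simp: zH_def)
    also have "\<dots> \<le> 9 * (ennreal \<sigma>2 * ennreal (C * h powr (H + 1/2)))"
      using that by (intro mult_left_mono C) auto
    also have "\<dots> = ennreal (D * h powr (H + 1/2))"
      unfolding D_def using \<open>0 \<le> C\<close> by (simp add: ennreal_mult mult.assoc)
    finally show ?thesis .
  qed
  \<comment> \<open>\<open>2^n\<close> cells, each contributing \<open>h powr (H + 1/2)\<close>,
    leave the ratio \<open>2 powr (1 - (H + 1/2))\<close>, which is below 1 because
    \<open>H > 1/2\<close>.\<close>
  define q where "q = (2::real) powr (1/2 - H)"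
  have q: "0 < q" "q < 1"
    unfolding q_def using assms(1) powr_less_mono[of "1/2 - H" 0 2] by auto
  show "AE \<omega> in M. (\<lambda>n. \<Sum>j=1..2^n. (Y (real j * t / 2^n) \<omega> - Y ((real j - 1) * t / 2^n) \<omega>)\<^sup>2)
      \<longlonglongrightarrow> 0"
  proof (rule AE_tendsto_0_of_summable_nn_integral[where b = "\<lambda>n. D * t powr (H + 1/2) * q ^ n"])
    fix n :: nat
    \<comment> \<open>Measurability of \<open>Y\<close> is available at nonnegative times only, and
      \<open>real j - 1\<close> is nonnegative because the index starts at 1.\<close>
    have meas: "(\<lambda>\<omega>. (Y (real j * t / 2^n) \<omega> - Y ((real j - 1) * t / 2^n) \<omega>)\<^sup>2) \<in> borel_measurable M"
      if "j \<in> {1..2^n}" for j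
      using that \<open>0 < t\<close> by (intro borel_measurable_power borel_measurable_diff Y_measurable) auto
    then show "(\<lambda>\<omega>. \<Sum>j=1..2^n. (Y (real j * t / 2^n) \<omega> - Y ((real j - 1) * t / 2^n) \<omega>)\<^sup>2)
        \<in> borel_measurable M"
      by (rule borel_measurable_sum)
    define h where "h = t / 2 ^ n"
    have "0 < h" unfolding h_def using \<open>0 < t\<close> by simp
    have "(\<integral>\<^sup>+\<omega>. ennreal (\<Sum>j=1..2^n. (Y (real j * t / 2^n) \<omega> - Y ((real j - 1) * t / 2^n) \<omega>)\<^sup>2) \<partial>M)
      = (\<Sum>j=1..2^n. \<integral>\<^sup>+\<omega>. ennreal ((Y (real j * t / 2^n) \<omega> - Y ((real j - 1) * t / 2^n) \<omega>)\<^sup>2) \<partial>M)"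
      using meas by (subst nn_integral_sum[symmetric]) (auto simp: sum_ennreal)
    also have "\<dots> \<le> (\<Sum>j\<in>{1..2^n :: nat}. ennreal (D * h powr (H + 1/2)))"
    proof (rule sum_mono)
      fix j :: nat assume j: "j \<in> {1..2^n}"
      define s where "s = (real j - 1) * h"
      have eq: "real j * t / 2^n = s + h" "(real j - 1) * t / 2^n = s"
        by (simp_all add: s_def h_def field_simps)
      \<comment> \<open>A dyadic cell either starts at 0 or lies at least one full cell length away
        from it, as the kernel bound demands.\<close>
      have "s = 0 \<or> h \<le> s"
      proof (cases "j = 1")
        case False
        then have "1 * h \<le> (real j - 1) * h"
          using j \<open>0 < h\<close> by (intro mult_right_mono) auto
        then show ?thesis by (simp add: s_def)
      qed (simp add: s_def)
      moreover have "s + h \<le> t"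
      proof -
        have "real j \<le> real (2 ^ n)" using j by (intro of_nat_mono) simp
        then have "real j * h \<le> 2 ^ n * h"
          using \<open>0 < h\<close> by (intro mult_right_mono) auto
        moreover have "2 ^ n * h = t" by (simp add: h_def)
        ultimately show ?thesis by (simp add: s_def left_diff_distrib)
      qed
      ultimately show "(\<integral>\<^sup>+\<omega>. ennreal ((Y (real j * t / 2^n) \<omega> - Y ((real j - 1) * t / 2^n) \<omega>)\<^sup>2) \<partial>M)
          \<le> ennreal (D * h powr (H + 1/2))"
        unfolding eq by (intro increment \<open>0 < h\<close>)
    qed
    also have "\<dots> = ennreal (2 ^ n * (D * h powr (H + 1/2)))"
      using \<open>0 \<le> D\<close> by (simp add: ennreal_mult flip: ennreal_power)
    also have "2 ^ n * (D * h powr (H + 1/2)) = D * t powr (H + 1/2) * q ^ n"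
    proof -
      have "2 ^ n * h powr (H + 1/2) = t powr (H + 1/2) * q ^ n"
        using dyadic_powr[of t n "H + 1/2"] \<open>0 < t\<close> unfolding h_def q_def by simp
      then have "D * (2 ^ n * h powr (H + 1/2)) = D * (t powr (H + 1/2) * q ^ n)" by simp
      then show ?thesis by (simp only: mult_ac)
    qed
    finally show "(\<integral>\<^sup>+\<omega>. ennreal (\<Sum>j=1..2^n. (Y (real j * t / 2^n) \<omega> - Y ((real j - 1) * t / 2^n) \<omega>)\<^sup>2) \<partial>M)
      \<le> ennreal (D * t powr (H + 1/2) * q ^ n)" .
  next
    show "0 \<le> (\<Sum>j=1..2^n. (Y (real j * t / 2^n) \<omega> - Y ((real j - 1) * t / 2^n) \<omega>)\<^sup>2)" for n \<omega>
      by (intro sum_nonneg) simp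
    show "0 \<le> D * t powr (H + 1/2) * q ^ n" for n using \<open>0 \<le> D\<close> q by simp
    show "summable (\<lambda>n. D * t powr (H + 1/2) * q ^ n)"
      using q by (intro summable_mult summable_geometric) simp
  qed
qed

end
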